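(* Assume: (i) $\Sigma_2 \succ 0$; (ii) the self-adjoint positive semi-definite operators $T_1,T_2,T_3$ are chosen such that the sequence $\{(x_1^k,x_2^k,x_3^k,z^k)\}$ generated by Algorithm sPADMM is well defined; (iii) there exists $x'=(x_1',x_2',x_3') \in \mathrm{ri}(\mathrm{dom}(\theta_1)\times\mathrm{dom}(\theta_2)\times\mathrm{dom}(\theta_3))$ with $A_1^*x_1'+A_2^*x_2'+A_3^*x_3'=c$. Let $\{(x_1^k,x_2^k,x_3^k,z^k)\}$ be generated by Algorithm sPADMM with penalty parameter $\sigma\in(0,+\infty)$. (a) Let $\alpha\in(0,1]$ and let $(\bar x_1,\bar x_2,\bar x_3,\bar z)$ satisfy $-A_i\bar z\in\partial\theta_i(\bar x_i)$ for $i=1,2,3$ and $A^*\bar x-c=0$. Then, for any step-length $\tau\in(0,+\infty)$ and every integer $k\ge 1$, $$\big(\overline{\phi}_k+\max(1-\tau,1-\tau^{-1})\,\sigma\|r^k\|^2+\xi_k\big)-\big(\overline{\phi}_{k+1}+\max(1-\tau,1-\tau^{-1})\,\sigma\|r^{k+1}\|^2+\xi_{k+1}\big)\ \ge\ t_{k+1}+\min(\tau,1+\tau-\tau^2)\,\sigma\tau^{-1}\|r^{k+1}\|^2 .$$ (b) Assume that $\tau\in(0,(1+\sqrt5)/2)$. If for some $\alpha\in(0,1]$ it holds that $$\tfrac12\Sigma_1+T_1+\sigma A_1A_1^*\succ 0,\qquad H\succ 0\qquad\text{and}\qquad M\succ 0,$$ then the whole sequence $\{(x_1^k,x_2^k,x_3^k)\}$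 converges to an optimal solution of the problem $\min\{\theta_1(x_1)+\theta_2(x_2)+\theta_3(x_3) : A_1^*x_1+A_2^*x_2+A_3^*x_3=c,\ x_i\in\mathcal X_i\}$, and $\{z^k\}$ converges to an optimal solution of the dual of this problem.
   Context: Setting. $\mathcal X_1,\mathcal X_2,\mathcal X_3,\mathcal Z$ are real finite dimensional Euclidean spaces, each with inner product $\langle\cdot,\cdot\rangle$ and induced norm $\|\cdot\|$. $\theta_i:\mathcal X_i\to(-\infty,+\infty]$, $i=1,2,3$, are closed proper convex functions with effective domains $\mathrm{dom}(\theta_i)$; $A_i:\mathcal Z\to\mathcal X_i$ are linear operators with adjoints $A_i^*:\mathcal X_i\to\mathcal Z$; $c\in\mathcal Z$. The problem is $$\min\{\theta_1(x_1)+\theta_2(x_2)+\theta_3(x_3)\;:\;A_1^*x_1+A_2^*x_2+A_3^*x_3=c,\ x_i\in\mathcal X_i,\ i=1,2,3\},$$ and its solution set is assumed nonempty. "The dual" is the Lagrangian dual with respect to the linear constraint, with multiplier $z\in\mathcal Z$ and Lagrangian $\sum_i\theta_i(x_i)+\langle z,\sum_iA_i^*x_i-c\rangle$. $\mathrm{ri}$ denotes relative interior. $\Sigma_i$ ($i=1,2,3$) are fixed self-adjoint positive semi-definite linear operators on $\mathcal X_i$ such that $\langle\hat x_i-x_i,\hat w_i-w_i\rangle\ge\langle\hat x_i-x_i,\Sigma_i(\hat x_i-x_i)\rangle$ for all $\hat x_i,x_i\in\mathrm{dom}(\theta_i)$, $\hat w_i\in\partial\theta_i(\hat x_i)$, $w_i\in\partial\theta_i(x_i)$,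 where $\partial\theta_i$ is the subdifferential. For self-adjoint $G$, write $\|x\|_G^2:=\langle x,Gx\rangle$ (also when $G$ is not positive semi-definite); $G\succ0$ means positive definite. Write $x=(x_1,x_2,x_3)$, $u=(x_2,x_3)\in\mathcal X_2\times\mathcal X_3$, $A^*x=A_1^*x_1+A_2^*x_2+A_3^*x_3$, $B:\mathcal Z\to\mathcal X_2\times\mathcal X_3$, $Bz=(A_2z,A_3z)$, so $B^*u=A_2^*x_2+A_3^*x_3$. Algorithm sPADMM. Let $\sigma\in(0,+\infty)$, $\tau\in(0,+\infty)$, and let $T_i$ be self-adjoint positive semi-definite linear operators on $\mathcal X_i$, $i=1,2,3$. With the augmented Lagrangian $$\mathcal L_\sigma(x_1,x_2,x_3;z)=\theta_1(x_1)+\theta_2(x_2)+\theta_3(x_3)+\langle z,A^*x-c\rangle+\tfrac{\sigma}{2}\|A^*x-c\|^2,$$ choose $(x_1^0,x_2^0,x_3^0,z^0)\in\mathrm{dom}(\theta_1)\times\mathrm{dom}(\theta_2)\times\mathrm{dom}(\theta_3)\times\mathcal Z$ and for $k=0,1,\dots$ compute $$\begin{aligned}x_1^{k+1}&:=\mathrm{argmin}_{x_1\in\mathcal X_1}\{\mathcal L_\sigma(x_1,x_2^k,x_3^k;z^k)+\tfrac12\|x_1-x_1^k\|_{T_1}^2\},\\ x_2^{k+1}&:=\mathrm{argmin}_{x_2\in\mathcal X_2}\{\mathcal L_\sigma(x_1^{k+1},x_2,x_3^k;z^k)+\tfrac12\|x_2-x_2^k\|_{T_2}^2\},\\ x_3^{k+1}&:=\mathrm{argmin}_{x_3\in\mathcal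 X_3}\{\mathcal L_\sigma(x_1^{k+1},x_2^{k+1},x_3;z^k)+\tfrac12\|x_3-x_3^k\|_{T_3}^2\},\\ z^{k+1}&:=z^k+\tau\sigma(A^*x^{k+1}-c).\end{aligned}$$ The sequence is considered infinite (no termination criterion). Operators on $\mathcal X_2\times\mathcal X_3$ depending on $\alpha\in(0,1]$: $$M:=\begin{pmatrix}(1-\alpha)\Sigma_2+T_2&0\\0&\Sigma_3+T_3\end{pmatrix}+\sigma BB^*,$$ $$H:=\begin{pmatrix}\frac{5(1-\alpha)}2\Sigma_2+T_2&0\\0&\frac52\Sigma_3+T_3-\frac{5\sigma^2}{2\alpha}(A_2A_3^* )^*\Sigma_2^{-1}(A_2A_3^* )\end{pmatrix}+\min(\tau,1+\tau-\tau^2)\,\sigma BB^*.$$ Quantities: $\Delta x_i^k:=x_i^{k+1}-x_i^k$, $\Delta u^k:=u^{k+1}-u^k$, $r^k:=A^*x^k-c$, and, with $\bar u=(\bar x_2,\bar x_3)$, $$\overline\phi_k:=(\sigma\tau)^{-1}\|z^k-\bar z\|^2+\|x_1^k-\bar x_1\|_{\Sigma_1+T_1}^2+\|u^k-\bar u\|_M^2,$$ $$\xi_{k+1}:=\|\Delta x_2^k\|_{T_2}^2+\|\Delta x_3^k\|^2_{T_3+\frac{\sigma^2}{\alpha}(A_2A_3^* )^*\Sigma_2^{-1}(A_2A_3^* )},\qquad t_{k+1}:=\|\Delta x_1^k\|^2_{\frac12\Sigma_1+T_1}+\|\Delta u^k\|_H^2 .$$ *)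

theory Defs
  imports "HOL-Analysis.Analysis"
begin

section \<open>Extended-real-valued convex functions\<close>

definition eff_dom :: "('a \<Rightarrow> ereal) \<Rightarrow> 'a set" where
  "eff_dom f = {x. f x < \<infinity>}"

definition proper :: "('a \<Rightarrow> ereal) \<Rightarrow> bool" where
  "proper f \<longleftrightarrow> eff_dom f \<noteq> {} \<and> (\<forall>x. - \<infinity> < f x)"

text \<open>The library's \<open>epigraph\<close> is for real-valued functions only.\<close>

definition ereal_epigraph :: "('a \<Rightarrow> ereal) \<Rightarrow> ('a \<times> real) set" where
  "ereal_epigraph f = {(x, r). f x \<le> ereal r}"

definition closed_proper_convex :: "('a::euclidean_space \<Rightarrow> ereal) \<Rightarrow> bool" where
  "closed_proper_convex f \<longleftrightarrow>
     proper f \<and> convex (ereal_epigraph f) \<and> closed (ereal_epigraph f)"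

definition subdifferential :: "('a::euclidean_space \<Rightarrow> ereal) \<Rightarrow> 'a \<Rightarrow> 'a set" where
  "subdifferential f x = {w. \<forall>y. f x + ereal (w \<bullet> (y - x)) \<le> f y}"


section \<open>Self-adjoint operators\<close>

definition self_adjoint :: "('a::euclidean_space \<Rightarrow> 'a) \<Rightarrow> bool" where
  "self_adjoint G \<longleftrightarrow> linear G \<and> adjoint G = G"

definition psd :: "('a::euclidean_space \<Rightarrow> 'a) \<Rightarrow> bool" where
  "psd G \<longleftrightarrow> self_adjoint G \<and> (\<forall>x. 0 \<le> x \<bullet> G x)"

definition pos_def :: "('a::euclidean_space \<Rightarrow> 'a) \<Rightarrow> bool" where
  "pos_def G \<longleftrightarrow> self_adjoint G \<and> (\<forall>x. x \<noteq> 0 \<longrightarrow> 0 < x \<bullet> G x)"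

text \<open>The squared \<open>G\<close>-norm \<open>\<parallel>x\<parallel>\<^sub>G\<^sup>2\<close>, which may be negative when \<open>G\<close> is indefinite.\<close>

definition sqn :: "('a::euclidean_space \<Rightarrow> 'a) \<Rightarrow> 'a \<Rightarrow> real" where
  "sqn G x = x \<bullet> G x"

definition monotone_modulus ::
  "('a::euclidean_space \<Rightarrow> ereal) \<Rightarrow> ('a \<Rightarrow> 'a) \<Rightarrow> bool" where
  "monotone_modulus f \<Sigma> \<longleftrightarrow>
     (\<forall>x\<in>eff_dom f. \<forall>x'\<in>eff_dom f. \<forall>w\<in>subdifferential f x. \<forall>w'\<in>subdifferential f x'.
        (x' - x) \<bullet> (w' - w) \<ge> (x' - x) \<bullet> \<Sigma> (x' - x))"


section \<open>The problem and its Lagrangian dual\<close>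

text \<open>Throughout, \<open>A\<^sub>i\<close> maps \<open>\<Z>\<close> to \<open>\<X>\<^sub>i\<close>, so the constraint involves the adjoints.\<close>

definition Astar ::
  "('z::euclidean_space \<Rightarrow> 'a::euclidean_space) \<Rightarrow> ('z \<Rightarrow> 'b::euclidean_space) \<Rightarrow>
   ('z \<Rightarrow> 'c::euclidean_space) \<Rightarrow> 'a \<Rightarrow> 'b \<Rightarrow> 'c \<Rightarrow> 'z" where
  "Astar A1 A2 A3 x1 x2 x3 = adjoint A1 x1 + adjoint A2 x2 + adjoint A3 x3"

definition primal_optimal ::
  "('a::euclidean_space \<Rightarrow> ereal) \<Rightarrow> ('b::euclidean_space \<Rightarrow> ereal) \<Rightarrow>
   ('c::euclidean_space \<Rightarrow> ereal) \<Rightarrow> ('z::euclidean_space \<Rightarrow> 'a) \<Rightarrow> ('z \<Rightarrow> 'b) \<Rightarrow> ('z \<Rightarrow> 'c) \<Rightarrow>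
   'z \<Rightarrow> 'a \<Rightarrow> 'b \<Rightarrow> 'c \<Rightarrow> bool" where
  "primal_optimal \<theta>1 \<theta>2 \<theta>3 A1 A2 A3 c x1 x2 x3 \<longleftrightarrow>
     x1 \<in> eff_dom \<theta>1 \<and> x2 \<in> eff_dom \<theta>2 \<and> x3 \<in> eff_dom \<theta>3 \<and> Astar A1 A2 A3 x1 x2 x3 = c \<and>
     (\<forall>y1 y2 y3. Astar A1 A2 A3 y1 y2 y3 = c \<longrightarrow>
        \<theta>1 x1 + \<theta>2 x2 + \<theta>3 x3 \<le> \<theta>1 y1 + \<theta>2 y2 + \<theta>3 y3)"

definition lagrangian ::
  "('a::euclidean_space \<Rightarrow> ereal) \<Rightarrow> ('b::euclidean_space \<Rightarrow> ereal) \<Rightarrow>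
   ('c::euclidean_space \<Rightarrow> ereal) \<Rightarrow> ('z::euclidean_space \<Rightarrow> 'a) \<Rightarrow> ('z \<Rightarrow> 'b) \<Rightarrow> ('z \<Rightarrow> 'c) \<Rightarrow>
   'z \<Rightarrow> 'a \<Rightarrow> 'b \<Rightarrow> 'c \<Rightarrow> 'z \<Rightarrow> ereal" where
  "lagrangian \<theta>1 \<theta>2 \<theta>3 A1 A2 A3 c x1 x2 x3 z =
     \<theta>1 x1 + \<theta>2 x2 + \<theta>3 x3 + ereal (z \<bullet> (Astar A1 A2 A3 x1 x2 x3 - c))"

definition dual_fun ::
  "('a::euclidean_space \<Rightarrow> ereal) \<Rightarrow> ('b::euclidean_space \<Rightarrow> ereal) \<Rightarrow>
   ('c::euclidean_space \<Rightarrow> ereal) \<Rightarrow> ('z::euclidean_space \<Rightarrow> 'a) \<Rightarrow> ('z \<Rightarrow> 'b) \<Rightarrow> ('z \<Rightarrow> 'c) \<Rightarrow>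
   'z \<Rightarrow> 'z \<Rightarrow> ereal" where
  "dual_fun \<theta>1 \<theta>2 \<theta>3 A1 A2 A3 c z =
     (INF (x1, x2, x3)\<in>UNIV. lagrangian \<theta>1 \<theta>2 \<theta>3 A1 A2 A3 c x1 x2 x3 z)"

text \<open>An optimal solution of the dual maximizes the dual function and is dual feasible, i.e. the
  dual value is not \<open>-\<infinity>\<close>.\<close>

definition dual_optimal ::
  "('a::euclidean_space \<Rightarrow> ereal) \<Rightarrow> ('b::euclidean_space \<Rightarrow> ereal) \<Rightarrow>
   ('c::euclidean_space \<Rightarrow> ereal) \<Rightarrow> ('z::euclidean_space \<Rightarrow> 'a) \<Rightarrow> ('z \<Rightarrow> 'b) \<Rightarrow> ('z \<Rightarrow> 'c) \<Rightarrow>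
   'z \<Rightarrow> 'z \<Rightarrow> bool" where
  "dual_optimal \<theta>1 \<theta>2 \<theta>3 A1 A2 A3 c z \<longleftrightarrow>
     - \<infinity> < dual_fun \<theta>1 \<theta>2 \<theta>3 A1 A2 A3 c z \<and>
     (\<forall>z'. dual_fun \<theta>1 \<theta>2 \<theta>3 A1 A2 A3 c z' \<le> dual_fun \<theta>1 \<theta>2 \<theta>3 A1 A2 A3 c z)"


section \<open>Algorithm sPADMM\<close>

definition aug_lagrangian ::
  "('a::euclidean_space \<Rightarrow> ereal) \<Rightarrow> ('b::euclidean_space \<Rightarrow> ereal) \<Rightarrow>
   ('c::euclidean_space \<Rightarrow> ereal) \<Rightarrow> ('z::euclidean_space \<Rightarrow> 'a) \<Rightarrow> ('z \<Rightarrow> 'b) \<Rightarrow> ('z \<Rightarrow> 'c) \<Rightarrow>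
   'z \<Rightarrow> real \<Rightarrow> 'a \<Rightarrow> 'b \<Rightarrow> 'c \<Rightarrow> 'z \<Rightarrow> ereal" where
  "aug_lagrangian \<theta>1 \<theta>2 \<theta>3 A1 A2 A3 c \<sigma> x1 x2 x3 z =
     lagrangian \<theta>1 \<theta>2 \<theta>3 A1 A2 A3 c x1 x2 x3 z
     + ereal (\<sigma> / 2 * (norm (Astar A1 A2 A3 x1 x2 x3 - c))\<^sup>2)"

text \<open>An infinite run of the algorithm. That the run is well defined is the existence of the
  minimizers required at every step; minimizers are not required to be unique.\<close>

definition sPADMM ::
  "('a::euclidean_space \<Rightarrow> ereal) \<Rightarrow> ('b::euclidean_space \<Rightarrow> ereal) \<Rightarrow>
   ('c::euclidean_space \<Rightarrow> ereal) \<Rightarrow> ('z::euclidean_space \<Rightarrow> 'a) \<Rightarrow> ('z \<Rightarrow> 'b) \<Rightarrow> ('z \<Rightarrow> 'c) \<Rightarrow>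
   'z \<Rightarrow> ('a \<Rightarrow> 'a) \<Rightarrow> ('b \<Rightarrow> 'b) \<Rightarrow> ('c \<Rightarrow> 'c) \<Rightarrow> real \<Rightarrow> real \<Rightarrow>
   (nat \<Rightarrow> 'a) \<Rightarrow> (nat \<Rightarrow> 'b) \<Rightarrow> (nat \<Rightarrow> 'c) \<Rightarrow> (nat \<Rightarrow> 'z) \<Rightarrow> bool" where
  "sPADMM \<theta>1 \<theta>2 \<theta>3 A1 A2 A3 c T1 T2 T3 \<sigma> \<tau> x1 x2 x3 z \<longleftrightarrow>
     x1 0 \<in> eff_dom \<theta>1 \<and> x2 0 \<in> eff_dom \<theta>2 \<and> x3 0 \<in> eff_dom \<theta>3 \<and>
     (\<forall>k.
        is_arg_min (\<lambda>y. aug_lagrangian \<theta>1 \<theta>2 \<theta>3 A1 A2 A3 c \<sigma> y (x2 k) (x3 k) (z k)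
                        + ereal (1 / 2 * sqn T1 (y - x1 k))) (\<lambda>_. True) (x1 (Suc k)) \<and>
        is_arg_min (\<lambda>y. aug_lagrangian \<theta>1 \<theta>2 \<theta>3 A1 A2 A3 c \<sigma> (x1 (Suc k)) y (x3 k) (z k)
                        + ereal (1 / 2 * sqn T2 (y - x2 k))) (\<lambda>_. True) (x2 (Suc k)) \<and>
        is_arg_min (\<lambda>y. aug_lagrangian \<theta>1 \<theta>2 \<theta>3 A1 A2 A3 c \<sigma> (x1 (Suc k)) (x2 (Suc k)) y (z k)
                        + ereal (1 / 2 * sqn T3 (y - x3 k))) (\<lambda>_. True) (x3 (Suc k)) \<and>
        z (Suc k) = z k + (\<tau> * \<sigma>) *\<^sub>R
                      (Astar A1 A2 A3 (x1 (Suc k)) (x2 (Suc k)) (x3 (Suc k)) - c))"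


section \<open>The operators and quantities of the analysis\<close>

definition B_op ::
  "('z \<Rightarrow> 'b::euclidean_space) \<Rightarrow> ('z \<Rightarrow> 'c::euclidean_space) \<Rightarrow> 'z \<Rightarrow> 'b \<times> 'c" where
  "B_op A2 A3 z = (A2 z, A3 z)"

text \<open>The operator \<open>(A\<^sub>2A\<^sub>3\<^sup>*)\<^sup>* \<Sigma>\<^sub>2\<^sup>-\<^sup>1 (A\<^sub>2A\<^sub>3\<^sup>*)\<close>; \<open>inv \<Sigma>2\<close> is meaningful because \<open>\<Sigma>2\<close> is
  positive definite wherever this is used.\<close>

definition cross_op ::
  "('b \<Rightarrow> 'b) \<Rightarrow> ('z::euclidean_space \<Rightarrow> 'b::euclidean_space) \<Rightarrow>
   ('z \<Rightarrow> 'c::euclidean_space) \<Rightarrow> 'c \<Rightarrow> 'c" where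
  "cross_op \<Sigma>2 A2 A3 = adjoint (A2 \<circ> adjoint A3) \<circ> inv \<Sigma>2 \<circ> (A2 \<circ> adjoint A3)"

definition M_op ::
  "('b \<Rightarrow> 'b) \<Rightarrow> ('c \<Rightarrow> 'c) \<Rightarrow> ('b \<Rightarrow> 'b) \<Rightarrow> ('c \<Rightarrow> 'c) \<Rightarrow>
   ('z::euclidean_space \<Rightarrow> 'b::euclidean_space) \<Rightarrow> ('z \<Rightarrow> 'c::euclidean_space) \<Rightarrow>
   real \<Rightarrow> real \<Rightarrow> 'b \<times> 'c \<Rightarrow> 'b \<times> 'c" where
  "M_op \<Sigma>2 \<Sigma>3 T2 T3 A2 A3 \<sigma> \<alpha> = (\<lambda>(u2, u3).
     ((1 - \<alpha>) *\<^sub>R \<Sigma>2 u2 + T2 u2, \<Sigma>3 u3 + T3 u3)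
     + \<sigma> *\<^sub>R B_op A2 A3 (adjoint (B_op A2 A3) (u2, u3)))"

definition H_op ::
  "('b \<Rightarrow> 'b) \<Rightarrow> ('c \<Rightarrow> 'c) \<Rightarrow> ('b \<Rightarrow> 'b) \<Rightarrow> ('c \<Rightarrow> 'c) \<Rightarrow>
   ('z::euclidean_space \<Rightarrow> 'b::euclidean_space) \<Rightarrow> ('z \<Rightarrow> 'c::euclidean_space) \<Rightarrow>
   real \<Rightarrow> real \<Rightarrow> real \<Rightarrow> 'b \<times> 'c \<Rightarrow> 'b \<times> 'c" where
  "H_op \<Sigma>2 \<Sigma>3 T2 T3 A2 A3 \<sigma> \<tau> \<alpha> = (\<lambda>(u2, u3).
     ((5 * (1 - \<alpha>) / 2) *\<^sub>R \<Sigma>2 u2 + T2 u2,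
      (5 / 2) *\<^sub>R \<Sigma>3 u3 + T3 u3 - (5 * \<sigma>\<^sup>2 / (2 * \<alpha>)) *\<^sub>R cross_op \<Sigma>2 A2 A3 u3)
     + (min \<tau> (1 + \<tau> - \<tau>\<^sup>2) * \<sigma>) *\<^sub>R B_op A2 A3 (adjoint (B_op A2 A3) (u2, u3)))"

definition \<Delta> :: "(nat \<Rightarrow> 'a::real_vector) \<Rightarrow> nat \<Rightarrow> 'a" where
  "\<Delta> x k = x (Suc k) - x k"

definition phi_bar ::
  "('a::euclidean_space \<Rightarrow> 'a) \<Rightarrow> ('b \<Rightarrow> 'b) \<Rightarrow> ('c \<Rightarrow> 'c) \<Rightarrow>
   ('a \<Rightarrow> 'a) \<Rightarrow> ('b \<Rightarrow> 'b) \<Rightarrow> ('c \<Rightarrow> 'c) \<Rightarrow>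
   ('z::euclidean_space \<Rightarrow> 'b::euclidean_space) \<Rightarrow> ('z \<Rightarrow> 'c::euclidean_space) \<Rightarrow>
   real \<Rightarrow> real \<Rightarrow> real \<Rightarrow> 'a \<Rightarrow> 'b \<Rightarrow> 'c \<Rightarrow> 'z \<Rightarrow>
   (nat \<Rightarrow> 'a) \<Rightarrow> (nat \<Rightarrow> 'b) \<Rightarrow> (nat \<Rightarrow> 'c) \<Rightarrow> (nat \<Rightarrow> 'z) \<Rightarrow> nat \<Rightarrow> real" where
  "phi_bar \<Sigma>1 \<Sigma>2 \<Sigma>3 T1 T2 T3 A2 A3 \<sigma> \<tau> \<alpha> xb1 xb2 xb3 zb x1 x2 x3 z k =
     inverse (\<sigma> * \<tau>) * (norm (z k - zb))\<^sup>2
     + sqn (\<lambda>v. \<Sigma>1 v + T1 v) (x1 k - xb1)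
     + sqn (M_op \<Sigma>2 \<Sigma>3 T2 T3 A2 A3 \<sigma> \<alpha>) ((x2 k, x3 k) - (xb2, xb3))"

text \<open>The following two quantities, at index \<open>k + 1\<close>, are built from the differences \<open>\<Delta> x k\<close>;
  only indices \<open>k \<ge> 1\<close> are meaningful.\<close>

definition xi ::
  "('b \<Rightarrow> 'b) \<Rightarrow> ('b \<Rightarrow> 'b) \<Rightarrow> ('c \<Rightarrow> 'c) \<Rightarrow>
   ('z::euclidean_space \<Rightarrow> 'b::euclidean_space) \<Rightarrow> ('z \<Rightarrow> 'c::euclidean_space) \<Rightarrow>
   real \<Rightarrow> real \<Rightarrow> (nat \<Rightarrow> 'b) \<Rightarrow> (nat \<Rightarrow> 'c) \<Rightarrow> nat \<Rightarrow> real" where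
  "xi \<Sigma>2 T2 T3 A2 A3 \<sigma> \<alpha> x2 x3 k =
     sqn T2 (\<Delta> x2 (k - 1))
     + sqn (\<lambda>v. T3 v + (\<sigma>\<^sup>2 / \<alpha>) *\<^sub>R cross_op \<Sigma>2 A2 A3 v) (\<Delta> x3 (k - 1))"

definition t_seq ::
  "('a::euclidean_space \<Rightarrow> 'a) \<Rightarrow> ('b \<Rightarrow> 'b) \<Rightarrow> ('c \<Rightarrow> 'c) \<Rightarrow>
   ('a \<Rightarrow> 'a) \<Rightarrow> ('b \<Rightarrow> 'b) \<Rightarrow> ('c \<Rightarrow> 'c) \<Rightarrow>
   ('z::euclidean_space \<Rightarrow> 'b::euclidean_space) \<Rightarrow> ('z \<Rightarrow> 'c::euclidean_space) \<Rightarrow>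
   real \<Rightarrow> real \<Rightarrow> real \<Rightarrow>
   (nat \<Rightarrow> 'a) \<Rightarrow> (nat \<Rightarrow> 'b) \<Rightarrow> (nat \<Rightarrow> 'c) \<Rightarrow> nat \<Rightarrow> real" where
  "t_seq \<Sigma>1 \<Sigma>2 \<Sigma>3 T1 T2 T3 A2 A3 \<sigma> \<tau> \<alpha> x1 x2 x3 k =
     sqn (\<lambda>v. (1 / 2) *\<^sub>R \<Sigma>1 v + T1 v) (\<Delta> x1 (k - 1))
     + sqn (H_op \<Sigma>2 \<Sigma>3 T2 T3 A2 A3 \<sigma> \<tau> \<alpha>) (\<Delta> (\<lambda>j. (x2 j, x3 j)) (k - 1))"

end

theory Submission
  imports Defs
begin

text \<open>The minimizer of each subproblem yields a subgradient of \<open>\<theta>\<^sub>i\<close> at the new iterate. Pairing these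
  with the subgradients at a KKT point by strong monotonicity gives the basic estimate, in which two
  cross terms have no sign: \<open>\<sigma>\<langle>A\<^sub>2\<^sup>*e\<^sub>2, A\<^sub>3\<^sup>*\<Delta>x\<^sub>3\<rangle>\<close> is absorbed by the strong convexity of \<open>\<theta>\<^sub>2\<close>, with \<open>e\<^sub>2\<close>
  the error of the new \<open>x\<^sub>2\<close>, through
  Young's inequality in the \<open>\<Sigma>\<^sub>2\<close>-norm, and \<open>\<sigma>\<langle>B\<^sup>*\<Delta>u, r\<rangle>\<close> is controlled by pairing the subgradients
  of two consecutive iterations. The left-hand side of the descent inequality is thus a Lyapunov
  function; its decrease forces the residuals to vanish and the iterates to be bounded, every cluster
  point is a KKT point because subdifferentials have closed graphs, and the Lyapunov function taken
  at a cluster point tends to zero along a subsequence, hence along the whole sequence. A KKT point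
  exists by separation, the relative interior condition excluding a vertical hyperplane.\<close>

section \<open>Subgradients and multipliers\<close>

text \<open>The obstacle is the Gauss-Seidel order of blocks 2 and 3. Minimized jointly, both would
  see the new residual; instead block 2 sees it with the old x3. This produces three inner products
  of an \<open>adjoint A2\<close> with an \<open>adjoint A3\<close> image: the error of x2 against
  the new step of x3, and the new step of x2 against the new and the previous step of x3. Young's
  inequality charges 2\<alpha>, \<alpha> and \<alpha> of the \<Sigma>2 form for them. Of 2\<Sigma>2
  at the error, 2(1 - \<alpha>)\<Sigma>2 is left; the parallelogram law makes of it the telescoping
  (1 - \<alpha>)\<Sigma>2 of \<open>M_op\<close> and half of (1 - \<alpha>)\<Sigma>2 on the step.
  Pairing consecutive iterations adds (2 - 2\<alpha>)\<Sigma>2 on the step, hence 5(1 - \<alpha>)/2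
  in \<open>H_op\<close>. Likewise 5/2 = 1/2 + 2 for \<Sigma>3, while \<Sigma>1 keeps 1/2, as block
  1 is not paired. The \<open>cross_op\<close> coefficient 5/2 is 1/2 + 1 from the Young bounds on
  the new step of x3, plus 1 for the same term in the new \<open>xi\<close>; the old
  \<open>xi\<close> pays for the previous step.\<close>

lemma proper_real:
  assumes "proper f" "x \<in> eff_dom f"
  obtains v where "f x = ereal v"
  using assms unfolding proper_def eff_dom_def by (cases "f x") auto

lemma convex_ereal_epigraphD:
  assumes "convex (ereal_epigraph f)" "f x \<le> ereal r" "f y \<le> ereal s"
    "0 \<le> a" "0 \<le> b" "a + b = 1"
  shows "f (a *\<^sub>R x + b *\<^sub>R y) \<le> ereal (a * r + b * s)"
  using convexD[OF assms(1), of "(x, r)" "(y, s)" a b] assms(2-)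
  by (simp add: ereal_epigraph_def)

text \<open>If f x were infinite, the subgradient inequality would fail wherever f is finite. This
  supplies the domain membership that \<open>monotone_modulus\<close> asks for and that the
  definition of \<open>subdifferential\<close> leaves implicit.\<close>

lemma subdifferential_eff_dom:
  assumes "proper f" "w \<in> subdifferential f x"
  shows "x \<in> eff_dom f"
proof -
  obtain y where y: "f y < \<infinity>" using assms(1) unfolding proper_def eff_dom_def by auto
  have "f x + ereal (w \<bullet> (y - x)) \<le> f y" using assms(2) by (auto simp: subdifferential_def)
  then show ?thesis using y unfolding eff_dom_def by (cases "f x") auto
qed

lemma arg_min_eff_dom:
  assumes "proper f" "is_arg_min (\<lambda>y. f y + ereal (q y)) (\<lambda>_. True) x"
  shows "x \<in> eff_dom f"
proof -
  obtain y where y: "f y < \<infinity>" using assms(1) by (auto simp: proper_def eff_dom_def)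
  have "f x + ereal (q x) \<le> f y + ereal (q y)"
    using assms(2) by (auto simp: is_arg_min_linorder)
  then show ?thesis using y unfolding eff_dom_def by (cases "f x"; cases "f y") auto
qed

text \<open>Fermat's rule by directional comparison: test minimality on the segment towards y,
  cancel one factor t and let t tend to 0, where the curvature term vanishes. Giving q by its exact
  expansion replaces differentiation.\<close>

lemma arg_min_plus_quadratic:
  fixes f :: "'a::euclidean_space \<Rightarrow> ereal"
  assumes pr: "proper f" and conv: "convex (ereal_epigraph f)"
    and min: "is_arg_min (\<lambda>y. f y + ereal (q y)) (\<lambda>_. True) x"
    and q: "\<And>d t. q (x + t *\<^sub>R d) = q x + t * (g \<bullet> d) + t\<^sup>2 * Q d"
  shows "- g \<in> subdifferential f x"
proof -
  have le: "f x + ereal (q x) \<le> f y + ereal (q y)" for y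
    using min by (auto simp: is_arg_min_linorder)
  obtain y0 where y0: "y0 \<in> eff_dom f" using pr by (auto simp: proper_def)
  obtain v0 where v0: "f y0 = ereal v0" using proper_real[OF pr y0] .
  have "f x < \<infinity>" using le[of y0] v0 by (cases "f x") auto
  then have xd: "x \<in> eff_dom f" by (simp add: eff_dom_def)
  obtain v where v: "f x = ereal v" using proper_real[OF pr xd] .
  have "f x + ereal (- g \<bullet> (y - x)) \<le> f y" for y
  proof (cases "f y")
    case (real s)
    have ineq: "v - g \<bullet> (y - x) \<le> s + t * Q (y - x)" if t: "0 < t" "t < 1" for t
    proof -
      have "f ((1 - t) *\<^sub>R x + t *\<^sub>R y) \<le> ereal ((1 - t) * v + t * s)"
        using t v real by (intro convex_ereal_epigraphD[OF conv]) auto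
      moreover have "(1 - t) *\<^sub>R x + t *\<^sub>R y = x + t *\<^sub>R (y - x)" by (simp add: algebra_simps)
      ultimately have fy: "f (x + t *\<^sub>R (y - x)) \<le> ereal ((1 - t) * v + t * s)" by simp
      have "ereal (v + q x) \<le> f (x + t *\<^sub>R (y - x)) + ereal (q (x + t *\<^sub>R (y - x)))"
        using le[of "x + t *\<^sub>R (y - x)"] v by simp
      also have "\<dots> \<le> ereal ((1 - t) * v + t * s) + ereal (q (x + t *\<^sub>R (y - x)))"
        using fy by (rule add_right_mono)
      finally have "v + q x \<le> (1 - t) * v + t * s + q (x + t *\<^sub>R (y - x))" by simp
      then have "t * (v - g \<bullet> (y - x)) \<le> t * (s + t * Q (y - x))"
        unfolding q by (simp add: algebra_simps power2_eq_square)
      then show ?thesis using t by simp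
    qed
    have "((\<lambda>t. s + t * Q (y - x)) \<longlongrightarrow> s + 0 * Q (y - x)) (at_right 0)"
      by (intro tendsto_intros)
    then have "v - g \<bullet> (y - x) \<le> s + 0 * Q (y - x)"
    proof (rule tendsto_lowerbound)
      show "\<forall>\<^sub>F t in at_right 0. v - g \<bullet> (y - x) \<le> s + t * Q (y - x)"
        unfolding eventually_at_right_field using ineq by (intro exI[of _ 1]) auto
    qed simp
    then show ?thesis using real v by simp
  next
    case MInf
    then show ?thesis using pr by (auto simp: proper_def)
  qed simp
  then show ?thesis unfolding subdifferential_def by blast
qed

text \<open>The subgradient inequality at y says that the pair of x and f y - w \<bullet> (y - x)
  lies in the epigraph of f. This pair depends continuously on x and w, so closedness of the
  epigraph carries the inequality to the limit.\<close>

lemma subdifferential_closed_graph: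
  assumes f: "closed_proper_convex f"
    and w: "\<And>n. w n \<in> subdifferential f (x n)"
    and lim: "x \<longlonglongrightarrow> x'" "w \<longlonglongrightarrow> w'"
  shows "w' \<in> subdifferential f x'"
proof -
  have pr: "proper f" and cl: "closed (ereal_epigraph f)"
    using f by (auto simp: closed_proper_convex_def)
  have "f x' + ereal (w' \<bullet> (y - x')) \<le> f y" for y
  proof (cases "f y")
    case (real s)
    have "(x n, s - w n \<bullet> (y - x n)) \<in> ereal_epigraph f" for n
    proof -
      have "f (x n) + ereal (w n \<bullet> (y - x n)) \<le> f y"
        using w[of n] by (auto simp: subdifferential_def)
      then show ?thesis unfolding ereal_epigraph_def using real by (cases "f (x n)") auto
    qed
    moreover have "(\<lambda>n. (x n, s - w n \<bullet> (y - x n))) \<longlonglongrightarrow> (x', s - w' \<bullet> (y - x'))"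
      by (intro tendsto_intros lim)
    ultimately have "(x', s - w' \<bullet> (y - x')) \<in> ereal_epigraph f"
      by (rule closed_sequentially[OF cl])
    then show ?thesis unfolding ereal_epigraph_def using real by (cases "f x'") auto
  next
    case MInf
    then show ?thesis using pr by (auto simp: proper_def)
  qed simp
  then show ?thesis unfolding subdifferential_def by blast
qed

text \<open>The separating functional is taken in the span of the separated set, so it cannot vanish
  identically on that set; the relative interior point then excludes a vertical hyperplane.\<close>

lemma lagrange_multiplier:
  fixes F :: "'x::euclidean_space \<Rightarrow> ereal" and L :: "'x \<Rightarrow> 'z::euclidean_space"
  assumes pr: "proper F" and conv: "convex (ereal_epigraph F)" and L: "linear L"
    and x': "x' \<in> rel_interior (eff_dom F)" "L x' = c"
    and min: "\<And>x. L x = c \<Longrightarrow> ereal v \<le> F x"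
  obtains z where "\<And>x. ereal v \<le> F x + ereal (z \<bullet> (L x - c))"
proof -
  \<comment> \<open>Pairs of a constraint defect and a strict bound on the excess of F over v. The
    intermediate \<open>\<rho>\<close> expresses strictness by reals; strictness keeps the origin
    out of S, as v is a lower bound of F on the feasible set.\<close>
  define S where "S = {(L x - c, s) | x s. \<exists>\<rho><s. F x \<le> ereal (v + \<rho>)}"
  have inS: "(L x - c, s) \<in> S" if "F x \<le> ereal (v + \<rho>)" "\<rho> < s" for x s \<rho>
    using that by (auto simp: S_def)
  have "x' \<in> eff_dom F" using x' rel_interior_subset by blast
  then obtain v' where v': "F x' = ereal v'" using proper_real[OF pr] by blast
  have x'S: "(0, s) \<in> S" if "s > v' - v" for s
    using inS[of x' "v' - v" s] that v' x'(2) by simp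
  have "convex S"
  proof (rule convexI)
    fix p q :: "'z \<times> real" and a b :: real
    assume "p \<in> S" "q \<in> S" and ab: "0 \<le> a" "0 \<le> b" "a + b = 1"
    then obtain x s \<rho> y t \<rho>' where p: "p = (L x - c, s)" "\<rho> < s" "F x \<le> ereal (v + \<rho>)"
      and q: "q = (L y - c, t)" "\<rho>' < t" "F y \<le> ereal (v + \<rho>')"
      unfolding S_def by blast
    have "F (a *\<^sub>R x + b *\<^sub>R y) \<le> ereal (a * (v + \<rho>) + b * (v + \<rho>'))"
      using p q ab by (intro convex_ereal_epigraphD[OF conv])
    also have "a * (v + \<rho>) + b * (v + \<rho>') = v + (a * \<rho> + b * \<rho>')"
      by (simp add: eq_diff_eq[THEN iffD2, OF ab(3)] algebra_simps)
    finally have 1: "F (a *\<^sub>R x + b *\<^sub>R y) \<le> ereal (v + (a * \<rho> + b * \<rho>'))" .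
    have 2: "a * \<rho> + b * \<rho>' < a * s + b * t"
    \<comment> \<open>Strictness comes from the first summand unless a = 0; then b = 1 and the
      second summand provides it.\<close>
    proof (cases "a = 0")
      case False
      with ab p q show ?thesis by (intro add_less_le_mono mult_strict_left_mono mult_left_mono) auto
    qed (use ab q in auto)
    have "c = a *\<^sub>R c + b *\<^sub>R c" using ab(3) by (simp flip: scaleR_left_distrib)
    then have "L (a *\<^sub>R x + b *\<^sub>R y) - c = a *\<^sub>R (L x - c) + b *\<^sub>R (L y - c)"
      by (simp add: linear_add[OF L] linear_cmul[OF L] algebra_simps)
    then show "a *\<^sub>R p + b *\<^sub>R q \<in> S" using inS[OF 1 2] p q by simp
  qed
  moreover have "S \<noteq> {}" using x'S[of "v' - v + 1"] by auto
  moreover have "0 \<notin> S"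
  proof
    assume "0 \<in> S"
    then obtain x \<rho> where "L x = c" "\<rho> < 0" "F x \<le> ereal (v + \<rho>)"
      unfolding S_def zero_prod_def by auto
    with min[of x] show False by (metis add_less_same_cancel1 ereal_less_eq(3) leD order_trans)
  qed
  ultimately obtain a where a: "a \<in> span S" "a \<noteq> 0" and aS: "\<And>p. p \<in> S \<Longrightarrow> 0 \<le> a \<bullet> p"
    using separating_hyperplane_set_0_inspan[of S] by blast
  obtain y \<eta> where ay: "a = (y, \<eta>)" by (cases a)
  \<comment> \<open>S contains a point above the origin with positive last coordinate, where the
    functional reduces to \<eta> times that coordinate.\<close>
  have \<eta>0: "\<eta> \<ge> 0"
  proof (rule ccontr)
    assume "\<not> \<eta> \<ge> 0"
    moreover have "0 \<le> \<eta> * (\<bar>v' - v\<bar> + 1)"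
      using aS[OF x'S[of "\<bar>v' - v\<bar> + 1"]] by (simp add: ay inner_prod_def)
    ultimately show False by (simp add: zero_le_mult_iff)
  qed
  have main: "0 \<le> y \<bullet> (L x - c) + \<eta> * s" if "F x \<le> ereal (v + \<rho>)" "\<rho> < s" for x s \<rho>
    using aS[OF inS[OF that]] by (simp add: ay inner_prod_def)
  have "\<eta> \<noteq> 0"
  proof
    assume \<eta>: "\<eta> = 0"
    have nonneg: "0 \<le> y \<bullet> (L x - c)" if xd: "x \<in> eff_dom F" for x
    proof -
      obtain u where "F x = ereal u" using proper_real[OF pr xd] .
      then show ?thesis using main[of x "u - v" "u - v + 1"] \<eta> by simp
    qed
    have zero: "y \<bullet> (L x - c) = 0" if xd: "x \<in> eff_dom F" for x
    proof -
      \<comment> \<open>As x' is relatively interior, the segment from x can be prolonged beyond x'.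
        At the new point the defect is (1 - e) times the one at x, because L x' = c, and 1 - e < 0
        reverses the sign.\<close>
      have "\<exists>e>1. (1 - e) *\<^sub>R x + e *\<^sub>R x' \<in> eff_dom F"
      proof -
        have "convex (eff_dom F)"
        proof (rule convexI)
          fix p q a b
          assume "p \<in> eff_dom F" "q \<in> eff_dom F" and ab: "(0::real) \<le> a" "0 \<le> b" "a + b = 1"
          then obtain r s where "F p = ereal r" "F q = ereal s" using proper_real[OF pr] by metis
          then have "F (a *\<^sub>R p + b *\<^sub>R q) \<le> ereal (a * r + b * s)"
            using ab by (intro convex_ereal_epigraphD[OF conv]) auto
          then show "a *\<^sub>R p + b *\<^sub>R q \<in> eff_dom F" by (auto simp: eff_dom_def)
        qed
        then show ?thesis using convex_rel_interior_iff[of "eff_dom F" x'] x'(1) xd by auto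
      qed
      then obtain e where e: "e > 1" "(1 - e) *\<^sub>R x + e *\<^sub>R x' \<in> eff_dom F" by blast
      have "L ((1 - e) *\<^sub>R x + e *\<^sub>R x') - c = (1 - e) *\<^sub>R (L x - c)"
        unfolding linear_add[OF L] linear_cmul[OF L] x'(2) by (simp add: algebra_simps)
      then have "0 \<le> (1 - e) * (y \<bullet> (L x - c))" using nonneg[OF e(2)] by simp
      with nonneg[OF xd] e(1) show ?thesis by (simp add: zero_le_mult_iff)
    qed
    have "a \<bullet> p = 0" if "p \<in> S" for p
    proof -
      obtain x s \<rho> where p: "p = (L x - c, s)" "F x \<le> ereal (v + \<rho>)"
        using \<open>p \<in> S\<close> unfolding S_def by blast
      then have "x \<in> eff_dom F" by (auto simp: eff_dom_def)
      then show ?thesis using zero p \<eta> ay by (simp add: inner_prod_def)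
    qed
    \<comment> \<open>Since a lies in \<open>span S\<close>, orthogonality to S makes a orthogonal
      to itself.\<close>
    then have "\<forall>p\<in>span S. a \<bullet> p = 0"
      by (metis orthogonal_def orthogonal_to_span)
    then show False using a by auto
  qed
  with \<eta>0 have \<eta>: "\<eta> > 0" by simp
  have "ereal v \<le> F x + ereal ((1 / \<eta>) *\<^sub>R y \<bullet> (L x - c))" for x
  proof (cases "F x")
    case (real u)
    \<comment> \<open>The margin e / \<eta> meets the strict inequality built into S and is then
      sent to 0.\<close>
    have "0 \<le> y \<bullet> (L x - c) + \<eta> * (u - v) + e" if "e > 0" for e
      using main[of x "u - v" "u - v + e / \<eta>"] \<eta> that real by (simp add: distrib_left)
    then have "0 \<le> y \<bullet> (L x - c) + \<eta> * (u - v)" by (rule field_le_epsilon)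
    then have "v \<le> u + (y \<bullet> (L x - c)) / \<eta>" using \<eta> by (simp add: field_simps)
    then show ?thesis using real by simp
  next
    case MInf
    then show ?thesis using pr by (auto simp: proper_def)
  qed simp
  then show thesis by (rule that)
qed

section \<open>Quadratic forms\<close>

lemma self_adjoint_inner:
  assumes "self_adjoint G"
  shows "x \<bullet> G y = y \<bullet> G x"
  using adjoint_works[of G x y] assms by (simp add: self_adjoint_def inner_commute)

lemma psdD:
  assumes "psd G"
  shows "linear G" "x \<bullet> G y = y \<bullet> G x" "0 \<le> x \<bullet> G x"
  using assms self_adjoint_inner by (auto simp: psd_def self_adjoint_def)

lemma sqn_scaleR_add:
  assumes "self_adjoint G"
  shows "sqn G (x + t *\<^sub>R y) = sqn G x + 2 * t * (y \<bullet> G x) + t\<^sup>2 * sqn G y"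
proof -
  have "linear G" using assms by (simp add: self_adjoint_def)
  then show ?thesis
    by (simp add: sqn_def linear_add linear_cmul inner_left_distrib inner_right_distrib
        self_adjoint_inner[OF assms, of x y] power2_eq_square algebra_simps)
qed

lemma sqn_diff:
  assumes "self_adjoint G"
  shows "sqn G (x - y) = sqn G x - 2 * (x \<bullet> G y) + sqn G y"
  using sqn_scaleR_add[OF assms, of x "-1" y] self_adjoint_inner[OF assms, of x y] by simp

lemma sqn_nonneg: "psd G \<Longrightarrow> 0 \<le> sqn G x"
  by (simp add: psd_def sqn_def)

lemma psd_self_adjoint: "psd G \<Longrightarrow> self_adjoint G"
  by (simp add: psd_def)

text \<open>Expand the G-square of x - y/2. In use, x and x - y are the new and the old error and y
  is the step: a squared error yields a telescoping difference plus half the squared step.\<close>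

lemma psd_parallelogram:
  assumes "psd G"
  shows "sqn G x + sqn G (x - y) \<ge> 1 / 2 * sqn G y"
proof -
  have sa: "self_adjoint G" using assms by (rule psd_self_adjoint)
  have "0 \<le> sqn G (x - (1 / 2) *\<^sub>R y)" using assms by (rule sqn_nonneg)
  also have "\<dots> = sqn G x - (y \<bullet> G x) + 1 / 4 * sqn G y"
    using sqn_scaleR_add[OF sa, of x "- (1 / 2)" y] by (simp add: power2_eq_square)
  finally show ?thesis using sqn_diff[OF sa, of x y] self_adjoint_inner[OF sa, of x y] by simp
qed

lemma pos_def_psd:
  assumes "pos_def G"
  shows "psd G"
proof -
  have "0 \<le> x \<bullet> G x" for x
    using assms unfolding pos_def_def by (cases "x = 0") (auto intro: less_imp_le)
  then show ?thesis using assms by (simp add: psd_def pos_def_def)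
qed

text \<open>A trivial kernel in finite dimension gives surjectivity, so \<open>inv\<close> in
  \<open>cross_op\<close> is a true inverse.\<close>

lemma pos_def_inverse:
  assumes "pos_def G"
  shows "G (inv G y) = y"
proof -
  have lin: "linear G" and pos: "\<And>x. x \<noteq> 0 \<Longrightarrow> 0 < x \<bullet> G x"
    using assms by (auto simp: pos_def_def self_adjoint_def)
  have "x = 0" if "G x = 0" for x using pos[of x] that by auto
  then have "inj G" using linear_injective_0[OF lin] by blast
  then have "surj G" using linear_injective_imp_surjective[OF lin] by blast
  then show ?thesis by (rule surj_f_inv_f)
qed

text \<open>The form of \<open>cross_op\<close> is the squared norm, dual to the S-norm, of A2
  (adjoint A3 v). Passing to the preimage h under S lets the estimates work with the form of S
  itself.\<close>

lemma sqn_cross_op: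
  assumes "pos_def S" "linear A2" "linear A3"
  defines "h v \<equiv> inv S (A2 (adjoint A3 v))"
  shows "sqn (cross_op S A2 A3) v = sqn S (h v)" "S (h v) = A2 (adjoint A3 v)"
proof -
  show *: "S (h v) = A2 (adjoint A3 v)" by (simp add: h_def pos_def_inverse[OF assms(1)])
  have "linear (A2 \<circ> adjoint A3)"
    using assms(2,3) by (intro linear_compose adjoint_linear)
  then have "sqn (cross_op S A2 A3) v = A2 (adjoint A3 v) \<bullet> h v"
    unfolding sqn_def cross_op_def h_def by (simp add: adjoint_works)
  then show "sqn (cross_op S A2 A3) v = sqn S (h v)" by (simp add: sqn_def * inner_commute)
qed

text \<open>Expand g times the S-square of s - h / g; as S h = A2 (adjoint A3 v), the mixed term is
  the inner product on the left.\<close>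

lemma cross_op_young:
  assumes S: "pos_def S" and lin: "linear A2" "linear A3" and g: "g > 0"
  shows "2 * (adjoint A2 s \<bullet> adjoint A3 v) \<le> g * sqn S s + 1 / g * sqn (cross_op S A2 A3) v"
proof -
  define h where "h = inv S (A2 (adjoint A3 v))"
  have h: "sqn (cross_op S A2 A3) v = sqn S h" "S h = A2 (adjoint A3 v)"
    unfolding h_def by (rule sqn_cross_op[OF S lin])+
  have sa: "self_adjoint S" using S by (simp add: pos_def_def)
  have "0 \<le> sqn S (s + (- 1 / g) *\<^sub>R h)"
    by (rule sqn_nonneg[OF pos_def_psd[OF S]])
  also have "\<dots> = sqn S s - 2 / g * (h \<bullet> S s) + 1 / g\<^sup>2 * sqn S h"
    unfolding sqn_scaleR_add[OF sa] by (simp add: power_divide)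
  finally have "0 \<le> g * (sqn S s - 2 / g * (h \<bullet> S s) + 1 / g\<^sup>2 * sqn S h)" using g by simp
  also have "\<dots> = g * sqn S s - 2 * (h \<bullet> S s) + 1 / g * sqn S h"
    using g by (simp add: field_simps power2_eq_square)
  also have "h \<bullet> S s = adjoint A2 s \<bullet> adjoint A3 v"
    by (simp add: self_adjoint_inner[OF sa, of h s] h(2) adjoint_clauses[OF lin(1)])
  finally show ?thesis using h(1) by simp
qed

lemma adjoint_B_op:
  fixes A2 :: "'z::euclidean_space \<Rightarrow> 'b::euclidean_space" and A3 :: "'z \<Rightarrow> 'c::euclidean_space"
  assumes "linear A2" "linear A3"
  shows "adjoint (B_op A2 A3) (u, v) = adjoint A2 u + adjoint A3 v"
proof -
  have "adjoint (B_op A2 A3) = (\<lambda>(u, v). adjoint A2 u + adjoint A3 v)"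
    by (rule adjoint_unique)
      (auto simp: B_op_def inner_add_right adjoint_works[OF assms(1)] adjoint_works[OF assms(2)])
  then show ?thesis by simp
qed

lemma inner_B_op:
  fixes A2 :: "'z::euclidean_space \<Rightarrow> 'b::euclidean_space" and A3 :: "'z \<Rightarrow> 'c::euclidean_space"
  assumes "linear A2" "linear A3"
  shows "(u, v) \<bullet> B_op A2 A3 w = (adjoint A2 u + adjoint A3 v) \<bullet> w"
  by (simp add: B_op_def inner_add_left adjoint_clauses[OF assms(1)] adjoint_clauses[OF assms(2)])

lemma sqn_M_op:
  assumes "linear A2" "linear A3"
  shows "sqn (M_op S2 S3 T2 T3 A2 A3 \<sigma> \<alpha>) (u, v) =
    (1 - \<alpha>) * sqn S2 u + sqn T2 u + sqn S3 v + sqn T3 v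
    + \<sigma> * (norm (adjoint A2 u + adjoint A3 v))\<^sup>2"
  unfolding sqn_def M_op_def prod.case inner_add_right inner_scaleR_right inner_B_op[OF assms]
    adjoint_B_op[OF assms] power2_norm_eq_inner
  by (simp add: inner_add_right)

lemma sqn_H_op:
  assumes "linear A2" "linear A3"
  shows "sqn (H_op S2 S3 T2 T3 A2 A3 \<sigma> \<tau> \<alpha>) (u, v) =
    5 * (1 - \<alpha>) / 2 * sqn S2 u + sqn T2 u + 5 / 2 * sqn S3 v + sqn T3 v
    - 5 * \<sigma>\<^sup>2 / (2 * \<alpha>) * sqn (cross_op S2 A2 A3) v
    + min \<tau> (1 + \<tau> - \<tau>\<^sup>2) * \<sigma> * (norm (adjoint A2 u + adjoint A3 v))\<^sup>2"
  unfolding sqn_def H_op_def prod.case inner_add_right inner_scaleR_right inner_B_op[OF assms]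
    adjoint_B_op[OF assms] power2_norm_eq_inner
  by (simp add: inner_add_right inner_diff_right)

lemma proximal_step_subgradient:
  fixes A :: "'z::euclidean_space \<Rightarrow> 'a::euclidean_space"
  assumes f: "closed_proper_convex f" and A: "linear A" and T: "psd T"
    and min: "is_arg_min (\<lambda>y. f y + ereal (C + z \<bullet> (adjoint A y + b)
      + \<sigma> / 2 * (norm (adjoint A y + b))\<^sup>2 + 1 / 2 * sqn T (y - x0))) (\<lambda>_. True) x"
  shows "- (A (z + \<sigma> *\<^sub>R (adjoint A x + b)) + T (x - x0)) \<in> subdifferential f x"
proof (rule arg_min_plus_quadratic[OF _ _ min,
      where Q = "\<lambda>d. \<sigma> / 2 * (norm (adjoint A d))\<^sup>2 + 1 / 2 * sqn T d"])
  show "proper f" "convex (ereal_epigraph f)" using f by (auto simp: closed_proper_convex_def)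
  fix d t
  have lA: "adjoint A (x + t *\<^sub>R d) = adjoint A x + t *\<^sub>R adjoint A d"
    using adjoint_linear[OF A] by (simp add: linear_add linear_cmul)
  have "sqn T (x + t *\<^sub>R d - x0) = sqn T (x - x0) + 2 * t * (d \<bullet> T (x - x0)) + t\<^sup>2 * sqn T d"
    using sqn_scaleR_add[OF psd_self_adjoint[OF T], of "x - x0" t d]
    by (simp add: algebra_simps)
  moreover have "(norm (adjoint A x + t *\<^sub>R adjoint A d + b))\<^sup>2 = (norm (adjoint A x + b))\<^sup>2
      + 2 * t * (adjoint A d \<bullet> (adjoint A x + b)) + t\<^sup>2 * (norm (adjoint A d))\<^sup>2"
    unfolding power2_norm_eq_inner
    by (simp add: inner_add_left inner_add_right inner_commute power2_eq_square algebra_simps)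
  moreover have "A (z + \<sigma> *\<^sub>R (adjoint A x + b)) \<bullet> d
      = adjoint A d \<bullet> z + \<sigma> * (adjoint A d \<bullet> (adjoint A x + b))"
    by (simp add: adjoint_clauses[OF A, symmetric] inner_add_left inner_add_right inner_commute
        algebra_simps)
  ultimately show "C + z \<bullet> (adjoint A (x + t *\<^sub>R d) + b)
      + \<sigma> / 2 * (norm (adjoint A (x + t *\<^sub>R d) + b))\<^sup>2 + 1 / 2 * sqn T (x + t *\<^sub>R d - x0)
    = C + z \<bullet> (adjoint A x + b) + \<sigma> / 2 * (norm (adjoint A x + b))\<^sup>2 + 1 / 2 * sqn T (x - x0)
      + t * ((A (z + \<sigma> *\<^sub>R (adjoint A x + b)) + T (x - x0)) \<bullet> d)
      + t\<^sup>2 * (\<sigma> / 2 * (norm (adjoint A d))\<^sup>2 + 1 / 2 * sqn T d)"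
    unfolding lA inner_add_left[of _ _ d]
    by (simp add: inner_add_left inner_add_right inner_commute algebra_simps)
qed

section \<open>Scalar identities and inequalities in the step length\<close>

lemma step_length_cases:
  fixes \<tau> :: real
  assumes "\<tau> > 0"
  shows "max (1 - \<tau>) (1 - inverse \<tau>) = (if \<tau> \<le> 1 then 1 - \<tau> else 1 - inverse \<tau>)"
    and "min \<tau> (1 + \<tau> - \<tau>\<^sup>2) = (if \<tau> \<le> 1 then \<tau> else 1 + \<tau> - \<tau>\<^sup>2)"
proof -
  show "max (1 - \<tau>) (1 - inverse \<tau>) = (if \<tau> \<le> 1 then 1 - \<tau> else 1 - inverse \<tau>)"
  proof (cases "\<tau> \<le> 1")
    case True
    then have "inverse \<tau> \<ge> 1" using assms by (intro one_le_inverse)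
    with True have "1 - inverse \<tau> \<le> 1 - \<tau>" by linarith
    with True show ?thesis by (simp add: max_absorb1)
  next
    case False
    then have "inverse \<tau> < 1" by (simp add: inverse_less_1_iff)
    with False have "1 - \<tau> \<le> 1 - inverse \<tau>" by linarith
    with False show ?thesis by (simp add: max_absorb2)
  qed
  show "min \<tau> (1 + \<tau> - \<tau>\<^sup>2) = (if \<tau> \<le> 1 then \<tau> else 1 + \<tau> - \<tau>\<^sup>2)"
  proof (cases "\<tau> \<le> 1")
    case True
    then have "\<tau>\<^sup>2 \<le> 1" using assms by (intro power_le_one) auto
    then have "\<tau> \<le> 1 + \<tau> - \<tau>\<^sup>2" by linarith
    with True show ?thesis by (simp add: min_absorb1)
  next
    case False
    then have "1 < \<tau>\<^sup>2" by (intro one_less_power) auto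
    then have "1 + \<tau> - \<tau>\<^sup>2 \<le> \<tau>" by linarith
    with False show ?thesis by (simp add: min_absorb2)
  qed
qed

text \<open>\<tau> - 2 is the coefficient of the new squared residual in the basic estimate. It
  splits exactly into the weight carried by the Lyapunov function and the weight left as
  decrease.\<close>

lemma step_length_coeffs:
  fixes \<tau> :: real
  assumes "\<tau> > 0"
  shows "\<tau> - 2 = - max (1 - \<tau>) (1 - inverse \<tau>) - min \<tau> (1 + \<tau> - \<tau>\<^sup>2) * inverse \<tau>"
    and "0 \<le> max (1 - \<tau>) (1 - inverse \<tau>)"
  using assms unfolding step_length_cases[OF assms]
  by (auto simp: field_simps power2_eq_square)

text \<open>Two completions of squares, with b - r for \<tau> \<le> 1 and \<tau> b + r for \<tau> >
  1. Here r is the old residual; its coefficient equals the one that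
  \<open>step_length_coeffs\<close> puts on the new residual, so the two telescope.\<close>

lemma step_length_bound:
  fixes b r :: "'z::real_inner"
  assumes \<tau>: "\<tau> > 0"
  shows "2 * (1 - \<tau>) * (b \<bullet> r) \<le> max (1 - \<tau>) (1 - inverse \<tau>) * (norm r)\<^sup>2
    + (1 - min \<tau> (1 + \<tau> - \<tau>\<^sup>2)) * (norm b)\<^sup>2"
proof (cases "\<tau> \<le> 1")
  case True
  have "0 \<le> (1 - \<tau>) * (norm (b - r))\<^sup>2" using True by simp
  also have "\<dots> = (1 - \<tau>) * (norm r)\<^sup>2 + (1 - \<tau>) * (norm b)\<^sup>2 - 2 * (1 - \<tau>) * (b \<bullet> r)"
    by (simp add: power2_norm_eq_inner inner_diff_left inner_diff_right inner_commute algebra_simps)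
  finally show ?thesis using True by (simp add: step_length_cases[OF \<tau>])
next
  case False
  have "0 \<le> (\<tau> - 1) / \<tau> * (norm (\<tau> *\<^sub>R b + r))\<^sup>2" using False by simp
  also have "\<dots> = (1 - inverse \<tau>) * (norm r)\<^sup>2 + (\<tau>\<^sup>2 - \<tau>) * (norm b)\<^sup>2
      - 2 * (1 - \<tau>) * (b \<bullet> r)"
    using \<tau> unfolding power2_norm_eq_inner
    by (simp add: inner_add_left inner_add_right inner_commute power2_eq_square field_simps)
  finally show ?thesis using False by (simp add: step_length_cases[OF \<tau>])
qed

text \<open>Read w as the multiplier error, r as the new residual, a2, a3 and b2, b3 as adjoint
  images of errors and steps; r - a2 - a3 is then the image of the error of x1. The right side is
  twice the sum of the three monotonicity pairings without proximal terms. Polarization turns it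
  into telescoping squares and leaves the products of b2 + b3 with r and of a2 with b3.\<close>

lemma multiplier_step_identity:
  fixes w r a2 a3 b2 b3 :: "'z::real_inner"
  assumes "\<sigma> > 0" "\<tau> > 0"
  shows "inverse (\<sigma> * \<tau>) * (norm w)\<^sup>2 - inverse (\<sigma> * \<tau>) * (norm (w + (\<tau> * \<sigma>) *\<^sub>R r))\<^sup>2
      + (\<tau> - 2) * (\<sigma> * (norm r)\<^sup>2) + 2 * \<sigma> * ((b2 + b3) \<bullet> r)
      + \<sigma> * (norm (a2 + a3 - (b2 + b3)))\<^sup>2 - \<sigma> * (norm (a2 + a3))\<^sup>2 - \<sigma> * (norm (b2 + b3))\<^sup>2
      + 2 * \<sigma> * (a2 \<bullet> b3)
    = 2 * (- (r \<bullet> w) - \<sigma> * ((r - a2 - a3) \<bullet> (r - b2 - b3)) - \<sigma> * (a2 \<bullet> (r - b3)) - \<sigma> * (a3 \<bullet> r))"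
proof -
  have "inverse (\<sigma> * \<tau>) * (norm w)\<^sup>2 - inverse (\<sigma> * \<tau>) * (norm (w + (\<tau> * \<sigma>) *\<^sub>R r))\<^sup>2
      = - 2 * (r \<bullet> w) - \<tau> * (\<sigma> * (norm r)\<^sup>2)"
    using assms by (simp add: power2_norm_eq_inner inner_add_left inner_add_right
        inner_commute field_simps)
  then show ?thesis
    by (simp add: power2_norm_eq_inner inner_add_left inner_add_right
        inner_diff_left inner_diff_right inner_commute algebra_simps)
qed

section \<open>Limits, boundedness and coercivity of quadratic forms\<close>

lemma linear_tendsto:
  fixes G :: "'a::euclidean_space \<Rightarrow> 'b::real_normed_vector"
  assumes "linear G" "(x \<longlongrightarrow> l) F"
  shows "((\<lambda>k. G (x k)) \<longlongrightarrow> G l) F"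
  using assms bounded_linear.tendsto linear_conv_bounded_linear by blast

lemma linear_tendsto_0:
  fixes G :: "'a::euclidean_space \<Rightarrow> 'b::real_normed_vector"
  assumes "linear G" "(x \<longlongrightarrow> 0) F"
  shows "((\<lambda>k. G (x k)) \<longlongrightarrow> 0) F"
  using linear_tendsto[OF assms] linear_0[OF assms(1)] by simp

lemma sqn_tendsto_0:
  assumes "linear G" "(x \<longlongrightarrow> 0) F"
  shows "((\<lambda>k. sqn G (x k)) \<longlongrightarrow> 0) F"
  unfolding sqn_def using tendsto_inner[OF assms(2) linear_tendsto_0[OF assms]] by simp

lemma bounded_range_linear:
  fixes G :: "'a::euclidean_space \<Rightarrow> 'b::real_normed_vector"
  assumes "linear G" "bounded (range x)"
  shows "bounded (range (\<lambda>k. G (x k)))"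
  using bounded_linear_image[OF assms(2), of G] assms(1)
  by (simp add: linear_conv_bounded_linear image_image)

text \<open>The form attains a positive minimum on the compact unit sphere; homogeneity extends the
  bound.\<close>

lemma pos_def_coercive:
  fixes G :: "'a::euclidean_space \<Rightarrow> 'a"
  assumes "pos_def G"
  obtains m where "m > 0" "\<And>x. m * (norm x)\<^sup>2 \<le> sqn G x"
proof -
  have lin: "linear G" and pos: "\<And>x. x \<noteq> 0 \<Longrightarrow> 0 < sqn G x"
    using assms by (auto simp: pos_def_def self_adjoint_def sqn_def)
  have "continuous_on (sphere 0 1) (sqn G)"
    unfolding sqn_def using lin
    by (intro continuous_intros linear_continuous_on) (simp add: linear_conv_bounded_linear)
  then obtain x0 where x0: "x0 \<in> sphere 0 1" "\<And>x. x \<in> sphere 0 1 \<Longrightarrow> sqn G x0 \<le> sqn G x"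
    using continuous_attains_inf[of "sphere 0 1" "sqn G"] by auto
  have "sqn G x0 * (norm x)\<^sup>2 \<le> sqn G x" for x
  proof (cases "x = 0")
    case False
    have "sqn G x0 \<le> sqn G (x /\<^sub>R norm x)" using False by (intro x0(2)) simp
    also have "\<dots> = sqn G x / (norm x)\<^sup>2"
      by (simp add: sqn_def linear_cmul[OF lin] power2_eq_square divide_inverse)
    finally show ?thesis using False by (simp add: field_simps)
  qed (simp add: sqn_def)
  moreover have "sqn G x0 > 0" using x0(1) by (intro pos) auto
  ultimately show thesis using that by blast
qed

lemma coercive_tendsto_0:
  fixes x :: "nat \<Rightarrow> 'a::real_normed_vector"
  assumes "m > 0" "\<And>k. m * (norm (x k))\<^sup>2 \<le> s k" "s \<longlonglongrightarrow> 0"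
  shows "x \<longlonglongrightarrow> 0"
proof -
  have "(\<lambda>k. s k / m) \<longlonglongrightarrow> 0" using tendsto_divide[OF assms(3) tendsto_const[of m]] assms(1) by simp
  moreover have "(norm (x k))\<^sup>2 \<le> s k / m" for k
    using assms(1) assms(2)[of k] by (simp add: field_simps)
  ultimately have "(\<lambda>k. (norm (x k))\<^sup>2) \<longlonglongrightarrow> 0"
    by (intro tendsto_sandwich[of "\<lambda>_. 0" "\<lambda>k. (norm (x k))\<^sup>2" sequentially "\<lambda>k. s k / m"]) simp_all
  then show ?thesis by (simp add: tendsto_norm_zero_iff)
qed

lemma coercive_bounded:
  fixes x :: "nat \<Rightarrow> 'a::real_normed_vector"
  assumes "m > 0" "\<And>k. m * (norm (x k - a))\<^sup>2 \<le> B"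
  shows "bounded (range x)"
proof -
  have "norm (x k - a) \<le> sqrt (B / m)" for k
    using assms(1) assms(2)[of k] by (intro real_le_rsqrt) (simp add: field_simps)
  then show ?thesis unfolding bounded_any_center[of _ a] by (auto simp: dist_norm norm_minus_commute)
qed

lemma pos_def_tendsto_0:
  fixes x :: "nat \<Rightarrow> 'a::euclidean_space"
  assumes "pos_def G" "(\<lambda>k. sqn G (x k)) \<longlonglongrightarrow> 0"
  shows "x \<longlonglongrightarrow> 0"
proof -
  obtain m where "m > 0" "\<And>x. m * (norm x)\<^sup>2 \<le> sqn G x" using pos_def_coercive[OF assms(1)] by blast
  then show ?thesis using coercive_tendsto_0[OF _ _ assms(2)] by blast
qed

lemma pos_def_bounded:
  fixes x :: "nat \<Rightarrow> 'a::euclidean_space"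
  assumes "pos_def G" "\<And>k. sqn G (x k - a) \<le> B"
  shows "bounded (range x)"
proof -
  obtain m where m: "m > 0" "\<And>x. m * (norm x)\<^sup>2 \<le> sqn G x" using pos_def_coercive[OF assms(1)] by blast
  show ?thesis using m(1) order_trans[OF m(2) assms(2)] by (rule coercive_bounded)
qed

text \<open>Serves to pass to the limit in the \<open>cross_op\<close> term of
  \<open>xi\<close>.\<close>

lemma linear_cross_op:
  assumes S: "pos_def S" and "linear A2" "linear A3"
  shows "linear (cross_op S A2 A3)"
proof -
  have "linear S" using S by (simp add: pos_def_def self_adjoint_def)
  moreover have "surj S" using pos_def_inverse[OF S] by (metis surjI)
  moreover have "inj S" using calculation linear_surjective_imp_injective by blast
  ultimately have "linear (inv S)" using inj_linear_imp_inv_linear by blast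
  then show ?thesis
    unfolding cross_op_def using assms(2,3) by (intro linear_compose adjoint_linear)
qed

lemma squeeze_0:
  fixes f g :: "nat \<Rightarrow> real"
  assumes "\<And>k. 0 \<le> f k" "\<And>k. f k \<le> g k" "g \<longlonglongrightarrow> 0"
  shows "f \<longlonglongrightarrow> 0"
  using assms by (intro tendsto_sandwich[of "\<lambda>_. 0" f sequentially g]) simp_all

lemma decseq_nonneg_convergent:
  fixes L :: "nat \<Rightarrow> real"
  assumes "decseq L" "\<And>k. 0 \<le> L k"
  shows "convergent L"
  using decseq_convergent[OF assms(1), of 0] assms(2) unfolding convergent_def by blast

lemma decseq_tendsto_0_subseq:
  fixes L :: "nat \<Rightarrow> real"
  assumes "decseq L" "\<And>k. 0 \<le> L k" "strict_mono \<rho>" "(L \<circ> \<rho>) \<longlonglongrightarrow> 0"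
  shows "L \<longlonglongrightarrow> 0"
proof -
  obtain l where l: "L \<longlonglongrightarrow> l"
    using decseq_nonneg_convergent[OF assms(1,2)] unfolding convergent_def by (elim exE)
  have "(L \<circ> \<rho>) \<longlonglongrightarrow> l" using LIMSEQ_subseq_LIMSEQ[OF l assms(3)] .
  then have "l = 0" using assms(4) LIMSEQ_unique by blast
  with l show ?thesis by simp
qed

section \<open>The descent inequality\<close>

text \<open>Subgradients from the subproblems and at a KKT point share the form -(A p + v), with a
  multiplier p and a proximal term v, which is 0 at a KKT point. Moving A across the inner product
  leaves adjoint images of differences, the quantities tied together by the constraint.\<close>

lemma strong_monotonicity:
  fixes A :: "'z::euclidean_space \<Rightarrow> 'a::euclidean_space"
  assumes "monotone_modulus f S" "proper f" "linear A"
    and "- (A p + v) \<in> subdifferential f x" "- (A q + w) \<in> subdifferential f y"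
  shows "- (adjoint A (x - y) \<bullet> (p - q)) - (x - y) \<bullet> v + (x - y) \<bullet> w \<ge> sqn S (x - y)"
proof -
  have "(x - y) \<bullet> (- (A p + v) - - (A q + w)) \<ge> (x - y) \<bullet> S (x - y)"
    using assms(1,4,5) subdifferential_eff_dom[OF assms(2)] unfolding monotone_modulus_def by blast
  then show ?thesis
    using adjoint_clauses(2)[OF assms(3), of "x - y" "p - q"]
    by (simp add: sqn_def linear_diff[OF assms(3)] inner_diff_right inner_add_right)
qed

locale spadmm_run =
  fixes \<theta>1 :: "'a::euclidean_space \<Rightarrow> ereal"
    and \<theta>2 :: "'b::euclidean_space \<Rightarrow> ereal"
    and \<theta>3 :: "'c::euclidean_space \<Rightarrow> ereal"
    and A1 :: "'z::euclidean_space \<Rightarrow> 'a" and A2 :: "'z \<Rightarrow> 'b" and A3 :: "'z \<Rightarrow> 'c"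
    and c :: 'z
    and \<Sigma>1 T1 :: "'a \<Rightarrow> 'a" and \<Sigma>2 T2 :: "'b \<Rightarrow> 'b" and \<Sigma>3 T3 :: "'c \<Rightarrow> 'c"
    and \<sigma> \<tau> :: real
    and x1 :: "nat \<Rightarrow> 'a" and x2 :: "nat \<Rightarrow> 'b" and x3 :: "nat \<Rightarrow> 'c" and z :: "nat \<Rightarrow> 'z"
  assumes cpc: "closed_proper_convex \<theta>1" "closed_proper_convex \<theta>2" "closed_proper_convex \<theta>3"
    and linear_A: "linear A1" "linear A2" "linear A3"
    and psd_\<Sigma>: "psd \<Sigma>1" "psd \<Sigma>2" "psd \<Sigma>3"
    and mono: "monotone_modulus \<theta>1 \<Sigma>1" "monotone_modulus \<theta>2 \<Sigma>2" "monotone_modulus \<theta>3 \<Sigma>3"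
    and psd_T: "psd T1" "psd T2" "psd T3"
    and \<sigma>: "\<sigma> > 0" and \<tau>: "\<tau> > 0"
    and pos_def_\<Sigma>2: "pos_def \<Sigma>2"
    and run: "sPADMM \<theta>1 \<theta>2 \<theta>3 A1 A2 A3 c T1 T2 T3 \<sigma> \<tau> x1 x2 x3 z"
begin

definition r :: "nat \<Rightarrow> 'z" where "r k = Astar A1 A2 A3 (x1 k) (x2 k) (x3 k) - c"

definition kkt :: "'a \<Rightarrow> 'b \<Rightarrow> 'c \<Rightarrow> 'z \<Rightarrow> bool" where
  "kkt xb1 xb2 xb3 zb \<longleftrightarrow> - A1 zb \<in> subdifferential \<theta>1 xb1 \<and> - A2 zb \<in> subdifferential \<theta>2 xb2 \<and>
     - A3 zb \<in> subdifferential \<theta>3 xb3 \<and> Astar A1 A2 A3 xb1 xb2 xb3 = c"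

section \<open>Optimality conditions of the three subproblems\<close>

lemma proper_\<theta>: "proper \<theta>1" "proper \<theta>2" "proper \<theta>3"
  using cpc by (auto simp: closed_proper_convex_def)

lemma z_Suc: "z (Suc k) = z k + (\<tau> * \<sigma>) *\<^sub>R r (Suc k)"
  using run by (auto simp: sPADMM_def r_def)

lemma block1_arg_min:
  assumes "x2 k \<in> eff_dom \<theta>2" "x3 k \<in> eff_dom \<theta>3"
  obtains C where "is_arg_min (\<lambda>y. \<theta>1 y + ereal (C
      + z k \<bullet> (adjoint A1 y + (adjoint A2 (x2 k) + adjoint A3 (x3 k) - c))
      + \<sigma> / 2 * (norm (adjoint A1 y + (adjoint A2 (x2 k) + adjoint A3 (x3 k) - c)))\<^sup>2
      + 1 / 2 * sqn T1 (y - x1 k))) (\<lambda>_. True) (x1 (Suc k))"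
proof -
  obtain p where p: "\<theta>2 (x2 k) = ereal p" using proper_real[OF proper_\<theta>(2) assms(1)] .
  obtain q where q: "\<theta>3 (x3 k) = ereal q" using proper_real[OF proper_\<theta>(3) assms(2)] .
  have "aug_lagrangian \<theta>1 \<theta>2 \<theta>3 A1 A2 A3 c \<sigma> y (x2 k) (x3 k) (z k) + ereal (1 / 2 * sqn T1 (y - x1 k))
    = \<theta>1 y + ereal (p + q
      + z k \<bullet> (adjoint A1 y + (adjoint A2 (x2 k) + adjoint A3 (x3 k) - c))
      + \<sigma> / 2 * (norm (adjoint A1 y + (adjoint A2 (x2 k) + adjoint A3 (x3 k) - c)))\<^sup>2
      + 1 / 2 * sqn T1 (y - x1 k))" for y
    unfolding aug_lagrangian_def lagrangian_def Astar_def p q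
    by (cases "\<theta>1 y") (simp_all add: add_diff_eq add.assoc)
  moreover have "is_arg_min (\<lambda>y. aug_lagrangian \<theta>1 \<theta>2 \<theta>3 A1 A2 A3 c \<sigma> y (x2 k) (x3 k) (z k)
      + ereal (1 / 2 * sqn T1 (y - x1 k))) (\<lambda>_. True) (x1 (Suc k))"
    using run unfolding sPADMM_def by blast
  ultimately show thesis using that by simp
qed

lemma block2_arg_min:
  assumes "x1 (Suc k) \<in> eff_dom \<theta>1" "x3 k \<in> eff_dom \<theta>3"
  obtains C where "is_arg_min (\<lambda>y. \<theta>2 y + ereal (C
      + z k \<bullet> (adjoint A2 y + (adjoint A1 (x1 (Suc k)) + adjoint A3 (x3 k) - c))
      + \<sigma> / 2 * (norm (adjoint A2 y + (adjoint A1 (x1 (Suc k)) + adjoint A3 (x3 k) - c)))\<^sup>2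
      + 1 / 2 * sqn T2 (y - x2 k))) (\<lambda>_. True) (x2 (Suc k))"
proof -
  obtain p where p: "\<theta>1 (x1 (Suc k)) = ereal p" using proper_real[OF proper_\<theta>(1) assms(1)] .
  obtain q where q: "\<theta>3 (x3 k) = ereal q" using proper_real[OF proper_\<theta>(3) assms(2)] .
  have "aug_lagrangian \<theta>1 \<theta>2 \<theta>3 A1 A2 A3 c \<sigma> (x1 (Suc k)) y (x3 k) (z k)
      + ereal (1 / 2 * sqn T2 (y - x2 k))
    = \<theta>2 y + ereal (p + q
      + z k \<bullet> (adjoint A2 y + (adjoint A1 (x1 (Suc k)) + adjoint A3 (x3 k) - c))
      + \<sigma> / 2 * (norm (adjoint A2 y + (adjoint A1 (x1 (Suc k)) + adjoint A3 (x3 k) - c)))\<^sup>2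
      + 1 / 2 * sqn T2 (y - x2 k))" for y
    unfolding aug_lagrangian_def lagrangian_def Astar_def p q
    by (cases "\<theta>2 y") (simp_all add: add_diff_eq add.assoc add.left_commute)
  moreover have "is_arg_min (\<lambda>y. aug_lagrangian \<theta>1 \<theta>2 \<theta>3 A1 A2 A3 c \<sigma> (x1 (Suc k)) y (x3 k) (z k)
      + ereal (1 / 2 * sqn T2 (y - x2 k))) (\<lambda>_. True) (x2 (Suc k))"
    using run unfolding sPADMM_def by blast
  ultimately show thesis using that by simp
qed

lemma block3_arg_min:
  assumes "x1 (Suc k) \<in> eff_dom \<theta>1" "x2 (Suc k) \<in> eff_dom \<theta>2"
  obtains C where "is_arg_min (\<lambda>y. \<theta>3 y + ereal (C
      + z k \<bullet> (adjoint A3 y + (adjoint A1 (x1 (Suc k)) + adjoint A2 (x2 (Suc k)) - c))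
      + \<sigma> / 2 * (norm (adjoint A3 y + (adjoint A1 (x1 (Suc k)) + adjoint A2 (x2 (Suc k)) - c)))\<^sup>2
      + 1 / 2 * sqn T3 (y - x3 k))) (\<lambda>_. True) (x3 (Suc k))"
proof -
  obtain p where p: "\<theta>1 (x1 (Suc k)) = ereal p" using proper_real[OF proper_\<theta>(1) assms(1)] .
  obtain q where q: "\<theta>2 (x2 (Suc k)) = ereal q" using proper_real[OF proper_\<theta>(2) assms(2)] .
  have "aug_lagrangian \<theta>1 \<theta>2 \<theta>3 A1 A2 A3 c \<sigma> (x1 (Suc k)) (x2 (Suc k)) y (z k)
      + ereal (1 / 2 * sqn T3 (y - x3 k))
    = \<theta>3 y + ereal (p + q
      + z k \<bullet> (adjoint A3 y + (adjoint A1 (x1 (Suc k)) + adjoint A2 (x2 (Suc k)) - c))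
      + \<sigma> / 2 * (norm (adjoint A3 y + (adjoint A1 (x1 (Suc k)) + adjoint A2 (x2 (Suc k)) - c)))\<^sup>2
      + 1 / 2 * sqn T3 (y - x3 k))" for y
    unfolding aug_lagrangian_def lagrangian_def Astar_def p q
    by (cases "\<theta>3 y") (simp_all add: add_diff_eq add.assoc add.commute add.left_commute)
  moreover have "is_arg_min (\<lambda>y. aug_lagrangian \<theta>1 \<theta>2 \<theta>3 A1 A2 A3 c \<sigma> (x1 (Suc k)) (x2 (Suc k)) y (z k)
      + ereal (1 / 2 * sqn T3 (y - x3 k))) (\<lambda>_. True) (x3 (Suc k))"
    using run unfolding sPADMM_def by blast
  ultimately show thesis using that by simp
qed

text \<open>The finiteness used to split each subproblem follows the order of updates: block 2
  relies on the new x1, block 3 on the new x1 and x2.\<close>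

lemma iterates_eff_dom: "x1 k \<in> eff_dom \<theta>1 \<and> x2 k \<in> eff_dom \<theta>2 \<and> x3 k \<in> eff_dom \<theta>3"
proof (induction k)
  case 0
  then show ?case using run by (simp add: sPADMM_def)
next
  case (Suc k)
  then have *: "x1 k \<in> eff_dom \<theta>1" "x2 k \<in> eff_dom \<theta>2" "x3 k \<in> eff_dom \<theta>3" by auto
  have 1: "x1 (Suc k) \<in> eff_dom \<theta>1"
    by (rule block1_arg_min[OF *(2,3)]) (erule arg_min_eff_dom[OF proper_\<theta>(1)])
  have 2: "x2 (Suc k) \<in> eff_dom \<theta>2"
    by (rule block2_arg_min[OF 1 *(3)]) (erule arg_min_eff_dom[OF proper_\<theta>(2)])
  have "x3 (Suc k) \<in> eff_dom \<theta>3"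
    by (rule block3_arg_min[OF 1 2]) (erule arg_min_eff_dom[OF proper_\<theta>(3)])
  with 1 2 show ?case by simp
qed

text \<open>The residual at an intermediate point is the new one less the images of the steps still
  to be taken. Unless \<tau> = 1, even the multiplier of block 3 differs in general from
  \<open>z (Suc k)\<close>.\<close>

lemma iterate_subgradients:
  shows "- (A1 (z k + \<sigma> *\<^sub>R (r (Suc k) - adjoint A2 (\<Delta> x2 k) - adjoint A3 (\<Delta> x3 k)))
      + T1 (\<Delta> x1 k)) \<in> subdifferential \<theta>1 (x1 (Suc k))"
    and "- (A2 (z k + \<sigma> *\<^sub>R (r (Suc k) - adjoint A3 (\<Delta> x3 k)))
      + T2 (\<Delta> x2 k)) \<in> subdifferential \<theta>2 (x2 (Suc k))"
    and "- (A3 (z k + \<sigma> *\<^sub>R r (Suc k)) + T3 (\<Delta> x3 k)) \<in> subdifferential \<theta>3 (x3 (Suc k))"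
proof -
  have lin: "adjoint A2 (\<Delta> x2 k) = adjoint A2 (x2 (Suc k)) - adjoint A2 (x2 k)"
    "adjoint A3 (\<Delta> x3 k) = adjoint A3 (x3 (Suc k)) - adjoint A3 (x3 k)"
    by (simp_all add: \<Delta>_def linear_A[THEN adjoint_linear, THEN linear_diff])
  obtain C1 where C1: "is_arg_min (\<lambda>y. \<theta>1 y + ereal (C1
      + z k \<bullet> (adjoint A1 y + (adjoint A2 (x2 k) + adjoint A3 (x3 k) - c))
      + \<sigma> / 2 * (norm (adjoint A1 y + (adjoint A2 (x2 k) + adjoint A3 (x3 k) - c)))\<^sup>2
      + 1 / 2 * sqn T1 (y - x1 k))) (\<lambda>_. True) (x1 (Suc k))"
    using block1_arg_min[of k] iterates_eff_dom by blast
  have e: "adjoint A1 (x1 (Suc k)) + (adjoint A2 (x2 k) + adjoint A3 (x3 k) - c)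
      = r (Suc k) - adjoint A2 (\<Delta> x2 k) - adjoint A3 (\<Delta> x3 k)"
    unfolding lin r_def Astar_def by simp
  show "- (A1 (z k + \<sigma> *\<^sub>R (r (Suc k) - adjoint A2 (\<Delta> x2 k) - adjoint A3 (\<Delta> x3 k)))
      + T1 (\<Delta> x1 k)) \<in> subdifferential \<theta>1 (x1 (Suc k))"
    using proximal_step_subgradient[OF cpc(1) linear_A(1) psd_T(1) C1] unfolding e \<Delta>_def .
  obtain C2 where C2: "is_arg_min (\<lambda>y. \<theta>2 y + ereal (C2
      + z k \<bullet> (adjoint A2 y + (adjoint A1 (x1 (Suc k)) + adjoint A3 (x3 k) - c))
      + \<sigma> / 2 * (norm (adjoint A2 y + (adjoint A1 (x1 (Suc k)) + adjoint A3 (x3 k) - c)))\<^sup>2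
      + 1 / 2 * sqn T2 (y - x2 k))) (\<lambda>_. True) (x2 (Suc k))"
    using block2_arg_min[of k] iterates_eff_dom by blast
  have e: "adjoint A2 (x2 (Suc k)) + (adjoint A1 (x1 (Suc k)) + adjoint A3 (x3 k) - c)
      = r (Suc k) - adjoint A3 (\<Delta> x3 k)"
    unfolding lin r_def Astar_def by simp
  show "- (A2 (z k + \<sigma> *\<^sub>R (r (Suc k) - adjoint A3 (\<Delta> x3 k)))
      + T2 (\<Delta> x2 k)) \<in> subdifferential \<theta>2 (x2 (Suc k))"
    using proximal_step_subgradient[OF cpc(2) linear_A(2) psd_T(2) C2] unfolding e \<Delta>_def .
  obtain C3 where C3: "is_arg_min (\<lambda>y. \<theta>3 y + ereal (C3
      + z k \<bullet> (adjoint A3 y + (adjoint A1 (x1 (Suc k)) + adjoint A2 (x2 (Suc k)) - c))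
      + \<sigma> / 2 * (norm (adjoint A3 y + (adjoint A1 (x1 (Suc k)) + adjoint A2 (x2 (Suc k)) - c)))\<^sup>2
      + 1 / 2 * sqn T3 (y - x3 k))) (\<lambda>_. True) (x3 (Suc k))"
    using block3_arg_min[of k] iterates_eff_dom by blast
  have e: "adjoint A3 (x3 (Suc k)) + (adjoint A1 (x1 (Suc k)) + adjoint A2 (x2 (Suc k)) - c)
      = r (Suc k)"
    unfolding r_def Astar_def by simp
  show "- (A3 (z k + \<sigma> *\<^sub>R r (Suc k)) + T3 (\<Delta> x3 k)) \<in> subdifferential \<theta>3 (x3 (Suc k))"
    using proximal_step_subgradient[OF cpc(3) linear_A(3) psd_T(3) C3] unfolding e \<Delta>_def .
qed

abbreviation "\<phi> \<alpha> xb1 xb2 xb3 zb \<equiv>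
  phi_bar \<Sigma>1 \<Sigma>2 \<Sigma>3 T1 T2 T3 A2 A3 \<sigma> \<tau> \<alpha> xb1 xb2 xb3 zb x1 x2 x3 z"
abbreviation "\<xi> \<alpha> \<equiv> xi \<Sigma>2 T2 T3 A2 A3 \<sigma> \<alpha> x2 x3"
abbreviation "t \<alpha> \<equiv> t_seq \<Sigma>1 \<Sigma>2 \<Sigma>3 T1 T2 T3 A2 A3 \<sigma> \<tau> \<alpha> x1 x2 x3"
abbreviation "\<kappa> \<equiv> max (1 - \<tau>) (1 - inverse \<tau>)"
abbreviation "\<mu> \<equiv> min \<tau> (1 + \<tau> - \<tau>\<^sup>2)"
abbreviation "X \<equiv> cross_op \<Sigma>2 A2 A3"

lemma phi_bar_eq:
  "\<phi> \<alpha> xb1 xb2 xb3 zb k = inverse (\<sigma> * \<tau>) * (norm (z k - zb))\<^sup>2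
    + (sqn \<Sigma>1 (x1 k - xb1) + sqn T1 (x1 k - xb1))
    + ((1 - \<alpha>) * sqn \<Sigma>2 (x2 k - xb2) + sqn T2 (x2 k - xb2)
      + sqn \<Sigma>3 (x3 k - xb3) + sqn T3 (x3 k - xb3)
      + \<sigma> * (norm (adjoint A2 (x2 k - xb2) + adjoint A3 (x3 k - xb3)))\<^sup>2)"
  by (simp add: phi_bar_def sqn_M_op[OF linear_A(2,3)]) (simp add: sqn_def inner_add_right)

lemma xi_Suc:
  "\<xi> \<alpha> (Suc k) = sqn T2 (\<Delta> x2 k) + sqn T3 (\<Delta> x3 k) + \<sigma>\<^sup>2 / \<alpha> * sqn X (\<Delta> x3 k)"
  by (simp add: xi_def sqn_def inner_add_right)

lemma t_seq_Suc:
  "t \<alpha> (Suc k) = 1 / 2 * sqn \<Sigma>1 (\<Delta> x1 k) + sqn T1 (\<Delta> x1 k)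
    + (5 * (1 - \<alpha>) / 2 * sqn \<Sigma>2 (\<Delta> x2 k) + sqn T2 (\<Delta> x2 k)
      + 5 / 2 * sqn \<Sigma>3 (\<Delta> x3 k) + sqn T3 (\<Delta> x3 k)
      - 5 * \<sigma>\<^sup>2 / (2 * \<alpha>) * sqn X (\<Delta> x3 k)
      + \<mu> * \<sigma> * (norm (adjoint A2 (\<Delta> x2 k) + adjoint A3 (\<Delta> x3 k)))\<^sup>2)"
proof -
  have "\<Delta> (\<lambda>j. (x2 j, x3 j)) k = (\<Delta> x2 k, \<Delta> x3 k)" by (simp add: \<Delta>_def)
  then show ?thesis
    by (simp add: t_seq_def sqn_H_op[OF linear_A(2,3)]) (simp add: sqn_def inner_add_right)
qed

text \<open>Stated at \<open>Suc k\<close> because the estimate combines the optimality conditions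
  of two consecutive iterations, so an earlier step has to exist.\<close>

lemma descent:
  assumes kkt: "kkt xb1 xb2 xb3 zb" and \<alpha>: "0 < \<alpha>" "\<alpha> \<le> 1"
  shows "(\<phi> \<alpha> xb1 xb2 xb3 zb (Suc k) + \<kappa> * \<sigma> * (norm (r (Suc k)))\<^sup>2 + \<xi> \<alpha> (Suc k))
    - (\<phi> \<alpha> xb1 xb2 xb3 zb (Suc (Suc k)) + \<kappa> * \<sigma> * (norm (r (Suc (Suc k))))\<^sup>2 + \<xi> \<alpha> (Suc (Suc k)))
    \<ge> t \<alpha> (Suc (Suc k)) + \<mu> * \<sigma> * inverse \<tau> * (norm (r (Suc (Suc k))))\<^sup>2"
proof -
  \<comment> \<open>Notation: e is the error after iteration K, d the step of that iteration and p
    the step before it; a, b and c3 are their adjoint images; r1 and r0 are the new and the old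
    residual.\<close>
  define K where "K = Suc k"
  define e1 where "e1 = x1 (Suc K) - xb1"
  define e2 where "e2 = x2 (Suc K) - xb2"
  define e3 where "e3 = x3 (Suc K) - xb3"
  define a2 where "a2 = adjoint A2 e2"
  define a3 where "a3 = adjoint A3 e3"
  define d1 where "d1 = \<Delta> x1 K"
  define d2 where "d2 = \<Delta> x2 K"
  define d3 where "d3 = \<Delta> x3 K"
  define b2 where "b2 = adjoint A2 d2"
  define b3 where "b3 = adjoint A3 d3"
  define p2 where "p2 = \<Delta> x2 k"
  define p3 where "p3 = \<Delta> x3 k"
  define c3 where "c3 = adjoint A3 p3"
  define w where "w = z K - zb"
  define r1 where "r1 = r (Suc K)"
  define r0 where "r0 = r K"
  note ladj = linear_A[THEN adjoint_linear]
  have a1: "adjoint A1 e1 = r1 - a2 - a3"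
  proof -
    have "c = adjoint A1 xb1 + adjoint A2 xb2 + adjoint A3 xb3"
      using kkt by (simp add: kkt_def Astar_def)
    then show ?thesis
      unfolding r1_def r_def Astar_def a2_def a3_def e1_def e2_def e3_def ladj[THEN linear_diff]
      by simp
  qed
  have prev: "x1 K - xb1 = e1 - d1" "x2 K - xb2 = e2 - d2" "x3 K - xb3 = e3 - d3"
    by (auto simp: e1_def e2_def e3_def d1_def d2_def d3_def \<Delta>_def)
  have "- A1 zb \<in> subdifferential \<theta>1 xb1" "- A2 zb \<in> subdifferential \<theta>2 xb2"
    "- A3 zb \<in> subdifferential \<theta>3 xb3" using kkt by (auto simp: kkt_def)
  then have kkt': "- (A1 zb + 0) \<in> subdifferential \<theta>1 xb1" "- (A2 zb + 0) \<in> subdifferential \<theta>2 xb2"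
    "- (A3 zb + 0) \<in> subdifferential \<theta>3 xb3" by simp_all
  note [simp] = inner_add_left inner_add_right inner_diff_left inner_diff_right
  have I1: "- (r1 - a2 - a3) \<bullet> (w + \<sigma> *\<^sub>R (r1 - b2 - b3)) - e1 \<bullet> T1 d1 \<ge> sqn \<Sigma>1 e1"
    using strong_monotonicity[OF mono(1) proper_\<theta>(1) linear_A(1) iterate_subgradients(1)[of K] kkt'(1)]
    unfolding e1_def[symmetric] a1 r1_def[symmetric] d1_def[symmetric] d2_def[symmetric]
      d3_def[symmetric] b2_def[symmetric] b3_def[symmetric]
    by (simp add: w_def algebra_simps)
  have I2: "- a2 \<bullet> (w + \<sigma> *\<^sub>R (r1 - b3)) - e2 \<bullet> T2 d2 \<ge> sqn \<Sigma>2 e2"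
    using strong_monotonicity[OF mono(2) proper_\<theta>(2) linear_A(2) iterate_subgradients(2)[of K] kkt'(2)]
    unfolding e2_def[symmetric] a2_def[symmetric] r1_def[symmetric] d2_def[symmetric]
      d3_def[symmetric] b3_def[symmetric]
    by (simp add: w_def algebra_simps)
  have I3: "- a3 \<bullet> (w + \<sigma> *\<^sub>R r1) - e3 \<bullet> T3 d3 \<ge> sqn \<Sigma>3 e3"
    using strong_monotonicity[OF mono(3) proper_\<theta>(3) linear_A(3) iterate_subgradients(3)[of K] kkt'(3)]
    unfolding e3_def[symmetric] a3_def[symmetric] r1_def[symmetric] d3_def[symmetric]
    by (simp add: w_def algebra_simps)
  have zK: "z K = z k + (\<tau> * \<sigma>) *\<^sub>R r0" unfolding K_def r0_def by (rule z_Suc)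
  \<comment> \<open>Between the two iterations the multiplier changes by \<tau>\<sigma> r0 and the
    penalty term by \<sigma> (r1 - r0), which gives the factor (\<tau> - 1) r0 + r1. The products
    with b3 and c3 come from the outdated x3 in block 2.\<close>
  have J2: "- \<sigma> * (b2 \<bullet> ((\<tau> - 1) *\<^sub>R r0 + r1)) + \<sigma> * (b2 \<bullet> (b3 - c3)) - d2 \<bullet> T2 d2 + d2 \<bullet> T2 p2
      \<ge> sqn \<Sigma>2 d2"
    using strong_monotonicity[OF mono(2) proper_\<theta>(2) linear_A(2) iterate_subgradients(2)[of K]
        iterate_subgradients(2)[of k]]
    unfolding K_def[symmetric]
    unfolding \<Delta>_def[of x2 K, symmetric] d2_def[symmetric] d3_def[symmetric] b2_def[symmetric]
      b3_def[symmetric] p2_def[symmetric] p3_def[symmetric] c3_def[symmetric] r0_def[symmetric]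
      r1_def[symmetric] zK
    by (simp add: algebra_simps)
  have J3: "- \<sigma> * (b3 \<bullet> ((\<tau> - 1) *\<^sub>R r0 + r1)) - d3 \<bullet> T3 d3 + d3 \<bullet> T3 p3 \<ge> sqn \<Sigma>3 d3"
    using strong_monotonicity[OF mono(3) proper_\<theta>(3) linear_A(3) iterate_subgradients(3)[of K]
        iterate_subgradients(3)[of k]]
    unfolding K_def[symmetric]
    unfolding \<Delta>_def[of x3 K, symmetric] d3_def[symmetric] b3_def[symmetric] p3_def[symmetric]
      r0_def[symmetric] r1_def[symmetric] zK
    by (simp add: algebra_simps)
  note [simp del] = inner_add_left inner_add_right inner_diff_left inner_diff_right
  note saT = psd_T[THEN psd_self_adjoint]
  have Y: "2 * (adjoint A2 s \<bullet> adjoint A3 v) \<le> g * sqn \<Sigma>2 s + 1 / g * sqn X v" if "g > 0" for s v g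
    using cross_op_young[OF pos_def_\<Sigma>2 linear_A(2,3) that] .
  \<comment> \<open>The weight 2\<alpha> / \<sigma> leaves exactly 2 (1 - \<alpha>) of the \<Sigma>2
    form at e2 for \<open>P2\<close>.\<close>
  have Y1: "2 * \<sigma> * (a2 \<bullet> b3) \<le> 2 * (\<alpha> * sqn \<Sigma>2 e2) + \<sigma>\<^sup>2 / (2 * \<alpha>) * sqn X d3"
  proof -
    have "\<sigma> * (2 * (a2 \<bullet> b3)) \<le> \<sigma> * (2 * \<alpha> / \<sigma> * sqn \<Sigma>2 e2 + 1 / (2 * \<alpha> / \<sigma>) * sqn X d3)"
      unfolding a2_def b3_def using \<sigma> \<alpha> by (intro mult_left_mono Y) auto
    also have "\<dots> = 2 * \<alpha> * sqn \<Sigma>2 e2 + \<sigma>\<^sup>2 / (2 * \<alpha>) * sqn X d3"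
      using \<sigma> \<alpha> by (simp add: distrib_left power2_eq_square)
    finally show ?thesis by simp
  qed
  have Y2: "2 * \<sigma> * (b2 \<bullet> b3) \<le> \<alpha> * sqn \<Sigma>2 d2 + \<sigma>\<^sup>2 / \<alpha> * sqn X d3"
  proof -
    have "\<sigma> * (2 * (b2 \<bullet> b3)) \<le> \<sigma> * (\<alpha> / \<sigma> * sqn \<Sigma>2 d2 + 1 / (\<alpha> / \<sigma>) * sqn X d3)"
      unfolding b2_def b3_def using \<sigma> \<alpha> by (intro mult_left_mono Y) auto
    also have "\<dots> = \<alpha> * sqn \<Sigma>2 d2 + \<sigma>\<^sup>2 / \<alpha> * sqn X d3"
      using \<sigma> \<alpha> by (simp add: distrib_left power2_eq_square)
    finally show ?thesis by simp
  qed
  \<comment> \<open>The \<open>cross_op\<close> term of the previous step p3 is the one stored in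
    \<open>\<xi>\<close> at K. The minus sign is handled by applying Young's inequality to
    -d2.\<close>
  have Y3: "- (2 * \<sigma> * (b2 \<bullet> c3)) \<le> \<alpha> * sqn \<Sigma>2 d2 + \<sigma>\<^sup>2 / \<alpha> * sqn X p3"
  proof -
    have neg: "adjoint A2 (- d2) = - b2" "sqn \<Sigma>2 (- d2) = sqn \<Sigma>2 d2"
      using psdD(1)[OF psd_\<Sigma>(2)] by (simp_all add: b2_def linear_neg ladj sqn_def)
    have "\<sigma> * (2 * (- b2 \<bullet> c3)) \<le> \<sigma> * (\<alpha> / \<sigma> * sqn \<Sigma>2 d2 + 1 / (\<alpha> / \<sigma>) * sqn X p3)"
      unfolding neg[symmetric] c3_def using \<sigma> \<alpha> by (intro mult_left_mono Y) auto
    also have "\<dots> = \<alpha> * sqn \<Sigma>2 d2 + \<sigma>\<^sup>2 / \<alpha> * sqn X p3"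
      using \<sigma> \<alpha> by (simp add: distrib_left power2_eq_square)
    finally show ?thesis by simp
  qed
  \<comment> \<open>Twice the sum of \<open>I1\<close>, \<open>I2\<close> and \<open>I3\<close>. The
    product of b2 + b3 with r1 is left to \<open>F\<close>, that of a2 with b3 to
    \<open>Y1\<close>.\<close>
  have E: "inverse (\<sigma> * \<tau>) * (norm w)\<^sup>2 - inverse (\<sigma> * \<tau>) * (norm (w + (\<tau> * \<sigma>) *\<^sub>R r1))\<^sup>2
      + (\<tau> - 2) * (\<sigma> * (norm r1)\<^sup>2) + 2 * \<sigma> * ((b2 + b3) \<bullet> r1)
      + \<sigma> * (norm (a2 + a3 - (b2 + b3)))\<^sup>2 - \<sigma> * (norm (a2 + a3))\<^sup>2 - \<sigma> * (norm (b2 + b3))\<^sup>2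
      + 2 * \<sigma> * (a2 \<bullet> b3)
      - 2 * (e1 \<bullet> T1 d1) - 2 * (e2 \<bullet> T2 d2) - 2 * (e3 \<bullet> T3 d3)
      \<ge> 2 * sqn \<Sigma>1 e1 + 2 * sqn \<Sigma>2 e2 + 2 * sqn \<Sigma>3 e3"
    unfolding multiplier_step_identity[OF \<sigma> \<tau>] using I1 I2 I3
    by (simp add: inner_add_left inner_add_right inner_diff_left inner_diff_right inner_commute
        algebra_simps)
  \<comment> \<open>Twice the sum of \<open>J2\<close> and \<open>J3\<close>. It trades r1 for the
    old residual r0, whose square is available in the Lyapunov function at K.\<close>
  have F: "2 * \<sigma> * ((b2 + b3) \<bullet> r1) \<le> \<sigma> * (2 * (1 - \<tau>) * ((b2 + b3) \<bullet> r0))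
      + 2 * \<sigma> * (b2 \<bullet> b3) - 2 * \<sigma> * (b2 \<bullet> c3) - 2 * sqn T2 d2 + 2 * (d2 \<bullet> T2 p2) - 2 * sqn T3 d3
      + 2 * (d3 \<bullet> T3 p3) - 2 * sqn \<Sigma>2 d2 - 2 * sqn \<Sigma>3 d3"
    using J2 J3 by (simp add: inner_add_left inner_add_right inner_diff_left inner_diff_right
        algebra_simps sqn_def)
  have TP: "2 * (d2 \<bullet> T2 p2) \<le> sqn T2 d2 + sqn T2 p2" "2 * (d3 \<bullet> T3 p3) \<le> sqn T3 d3 + sqn T3 p3"
    using sqn_nonneg[OF psd_T(2), of "d2 - p2"] sqn_nonneg[OF psd_T(3), of "d3 - p3"]
    by (simp_all add: sqn_diff saT)
  \<comment> \<open>The share 1 - \<mu> is set against the full negative square of b2 + b3 in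
    \<open>E\<close>, which leaves the \<mu> of \<open>H_op\<close>.\<close>
  have SB: "\<sigma> * (2 * (1 - \<tau>) * ((b2 + b3) \<bullet> r0)) \<le> \<sigma> * (\<kappa> * (norm r0)\<^sup>2
      + (1 - \<mu>) * (norm (b2 + b3))\<^sup>2)"
    using \<sigma> by (intro mult_left_mono step_length_bound[OF \<tau>]) auto
  have P1: "2 * sqn \<Sigma>1 e1 \<ge> sqn \<Sigma>1 e1 - sqn \<Sigma>1 (e1 - d1) + 1 / 2 * sqn \<Sigma>1 d1"
    using psd_parallelogram[OF psd_\<Sigma>(1), of d1 e1] by simp
  have P2: "2 * ((1 - \<alpha>) * sqn \<Sigma>2 e2) \<ge> (1 - \<alpha>) * sqn \<Sigma>2 e2 - (1 - \<alpha>) * sqn \<Sigma>2 (e2 - d2)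
      + 1 / 2 * ((1 - \<alpha>) * sqn \<Sigma>2 d2)"
    using mult_left_mono[OF psd_parallelogram[OF psd_\<Sigma>(2), of d2 e2], of "1 - \<alpha>"] \<alpha>
    unfolding distrib_left by linarith
  have P3: "2 * sqn \<Sigma>3 e3 \<ge> sqn \<Sigma>3 e3 - sqn \<Sigma>3 (e3 - d3) + 1 / 2 * sqn \<Sigma>3 d3"
    using psd_parallelogram[OF psd_\<Sigma>(3), of d3 e3] by simp
  have TE: "sqn T1 (e1 - d1) = sqn T1 e1 - 2 * (e1 \<bullet> T1 d1) + sqn T1 d1"
    "sqn T2 (e2 - d2) = sqn T2 e2 - 2 * (e2 \<bullet> T2 d2) + sqn T2 d2"
    "sqn T3 (e3 - d3) = sqn T3 e3 - 2 * (e3 \<bullet> T3 d3) + sqn T3 d3"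
    by (simp_all add: sqn_diff saT)
  have TC: "(\<tau> - 2) * (\<sigma> * (norm r1)\<^sup>2) = - (\<kappa> * \<sigma> * (norm r1)\<^sup>2) - \<mu> * \<sigma> * inverse \<tau> * (norm r1)\<^sup>2"
    unfolding step_length_coeffs(1)[OF \<tau>] by (simp add: algebra_simps)
  have zz: "z (Suc K) - zb = w + (\<tau> * \<sigma>) *\<^sub>R r1" by (simp add: z_Suc w_def r1_def)
  have bb: "adjoint A2 (e2 - d2) + adjoint A3 (e3 - d3) = a2 + a3 - (b2 + b3)"
    by (simp add: a2_def a3_def b2_def b3_def ladj[THEN linear_diff])
  \<comment> \<open>Each quadratic form is brought to one shape, so that the final summation is
    linear in common terms.\<close>
  have Q: "5 * \<sigma>\<^sup>2 / (2 * \<alpha>) * sqn X d3 = 5 / 2 * (\<sigma>\<^sup>2 / \<alpha> * sqn X d3)"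
    "\<sigma>\<^sup>2 / (2 * \<alpha>) * sqn X d3 = 1 / 2 * (\<sigma>\<^sup>2 / \<alpha> * sqn X d3)"
    "5 * (1 - \<alpha>) / 2 * sqn \<Sigma>2 d2 = 5 / 2 * ((1 - \<alpha>) * sqn \<Sigma>2 d2)"
    "(1 - \<alpha>) * sqn \<Sigma>2 d2 = sqn \<Sigma>2 d2 - \<alpha> * sqn \<Sigma>2 d2"
    "(1 - \<alpha>) * sqn \<Sigma>2 e2 = sqn \<Sigma>2 e2 - \<alpha> * sqn \<Sigma>2 e2"
    by (simp_all add: field_simps)
  have SB': "\<sigma> * (\<kappa> * (norm r0)\<^sup>2 + (1 - \<mu>) * (norm (b2 + b3))\<^sup>2)
    = \<kappa> * \<sigma> * (norm r0)\<^sup>2 + \<sigma> * (norm (b2 + b3))\<^sup>2 - \<mu> * \<sigma> * (norm (b2 + b3))\<^sup>2"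
    by (simp only: distrib_left left_diff_distrib right_diff_distrib) simp
  \<comment> \<open>The claim is the sum of all estimates with unit weights.\<close>
  note total = add_mono[OF E add_mono[OF F add_mono[OF TP(1) add_mono[OF TP(2) add_mono[OF SB
    add_mono[OF P1 add_mono[OF P2 add_mono[OF P3 add_mono[OF Y1 add_mono[OF Y2 Y3]]]]]]]]]]
  show ?thesis
    unfolding K_def[symmetric] phi_bar_eq t_seq_Suc xi_Suc[of \<alpha> K] xi_Suc[of \<alpha> k, folded K_def] prev zz
      e1_def[symmetric] e2_def[symmetric] e3_def[symmetric] bb a2_def[symmetric] a3_def[symmetric]
      d1_def[symmetric] d2_def[symmetric] d3_def[symmetric] b2_def[symmetric] b3_def[symmetric]
      p2_def[symmetric] p3_def[symmetric] w_def[symmetric] r1_def[symmetric] r0_def[symmetric]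
    using total[unfolded TC SB'] unfolding TE Q unfolding right_diff_distrib by linarith
qed

end

section \<open>Convergence\<close>

context spadmm_run
begin

section \<open>The Lyapunov function and its decrease\<close>

lemma mu_positive:
  assumes t: "\<tau> < (1 + sqrt 5) / 2"
  shows "0 < \<mu>"
proof -
  \<comment> \<open>The roots of 1 + \<tau> - \<tau>^2 are (1 + sqrt 5) / 2 and -(sqrt 5 - 1) /
    2.\<close>
  have "0 < ((1 + sqrt 5) / 2 - \<tau>) * (\<tau> + (sqrt 5 - 1) / 2)"
    using t \<tau> by (intro mult_pos_pos) (auto simp: add_pos_nonneg)
  also have "\<dots> = 1 + \<tau> - \<tau>\<^sup>2" by (simp add: power2_eq_square field_simps)
  finally show ?thesis using \<tau> by simp
qed

text \<open>Index k stands for iteration k + 1, the first at which the difference stored in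
  \<open>xi\<close> exists.\<close>

definition lyapunov :: "real \<Rightarrow> 'a \<Rightarrow> 'b \<Rightarrow> 'c \<Rightarrow> 'z \<Rightarrow> nat \<Rightarrow> real" where
  "lyapunov \<alpha> xb1 xb2 xb3 zb k =
     \<phi> \<alpha> xb1 xb2 xb3 zb (Suc k) + \<kappa> * \<sigma> * (norm (r (Suc k)))\<^sup>2 + \<xi> \<alpha> (Suc k)"

text \<open>Bounds the drop of \<open>lyapunov\<close> from index k to k + 1, hence the shift by
  two. It refers to no KKT point, so its limit can be used with every one of them.\<close>

definition decrement :: "real \<Rightarrow> nat \<Rightarrow> real" where
  "decrement \<alpha> k = t \<alpha> (Suc (Suc k)) + \<mu> * \<sigma> * inverse \<tau> * (norm (r (Suc (Suc k))))\<^sup>2"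

lemma sqn_X_nonneg: "0 \<le> sqn X v"
  unfolding sqn_cross_op[OF pos_def_\<Sigma>2 linear_A(2,3)] by (rule sqn_nonneg[OF psd_\<Sigma>(2)])

lemma xi_nonneg: "0 < \<alpha> \<Longrightarrow> 0 \<le> \<xi> \<alpha> (Suc k)"
  unfolding xi_Suc by (intro add_nonneg_nonneg mult_nonneg_nonneg sqn_nonneg psd_T sqn_X_nonneg) auto

lemma phi_bar_eq_M:
  "\<phi> \<alpha> xb1 xb2 xb3 zb k = inverse (\<sigma> * \<tau>) * (norm (z k - zb))\<^sup>2
    + (sqn \<Sigma>1 (x1 k - xb1) + sqn T1 (x1 k - xb1))
    + sqn (M_op \<Sigma>2 \<Sigma>3 T2 T3 A2 A3 \<sigma> \<alpha>) ((x2 k, x3 k) - (xb2, xb3))"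
  by (simp add: phi_bar_def) (simp add: sqn_def inner_add_right)

lemma t_seq_Suc_H:
  "t \<alpha> (Suc k) = 1 / 2 * sqn \<Sigma>1 (\<Delta> x1 k) + sqn T1 (\<Delta> x1 k)
    + sqn (H_op \<Sigma>2 \<Sigma>3 T2 T3 A2 A3 \<sigma> \<tau> \<alpha>) (\<Delta> (\<lambda>j. (x2 j, x3 j)) k)"
  by (simp add: t_seq_def) (simp add: sqn_def inner_add_right)

lemma lyapunov_decrease:
  assumes "kkt xb1 xb2 xb3 zb" "0 < \<alpha>" "\<alpha> \<le> 1"
  shows "lyapunov \<alpha> xb1 xb2 xb3 zb (Suc k) + decrement \<alpha> k \<le> lyapunov \<alpha> xb1 xb2 xb3 zb k"
  using descent[OF assms, of k] unfolding lyapunov_def decrement_def by linarith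

section \<open>KKT points: primal and dual optimality, existence\<close>

lemma kkt_lagrangian:
  assumes "kkt xb1 xb2 xb3 zb"
  obtains v1 v2 v3 where "\<theta>1 xb1 = ereal v1" "\<theta>2 xb2 = ereal v2" "\<theta>3 xb3 = ereal v3"
    "\<And>y1 y2 y3. ereal (v1 + v2 + v3) \<le> lagrangian \<theta>1 \<theta>2 \<theta>3 A1 A2 A3 c y1 y2 y3 zb"
proof -
  have sub: "- A1 zb \<in> subdifferential \<theta>1 xb1" "- A2 zb \<in> subdifferential \<theta>2 xb2"
    "- A3 zb \<in> subdifferential \<theta>3 xb3" and feas: "Astar A1 A2 A3 xb1 xb2 xb3 = c"
    using assms by (auto simp: kkt_def)
  obtain v1 where v1: "\<theta>1 xb1 = ereal v1"
    using proper_real[OF proper_\<theta>(1) subdifferential_eff_dom[OF proper_\<theta>(1) sub(1)]] .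
  obtain v2 where v2: "\<theta>2 xb2 = ereal v2"
    using proper_real[OF proper_\<theta>(2) subdifferential_eff_dom[OF proper_\<theta>(2) sub(2)]] .
  obtain v3 where v3: "\<theta>3 xb3 = ereal v3"
    using proper_real[OF proper_\<theta>(3) subdifferential_eff_dom[OF proper_\<theta>(3) sub(3)]] .
  have "ereal (v1 + v2 + v3) \<le> lagrangian \<theta>1 \<theta>2 \<theta>3 A1 A2 A3 c y1 y2 y3 zb" for y1 y2 y3
  proof -
    have "ereal v1 + ereal (- A1 zb \<bullet> (y1 - xb1)) \<le> \<theta>1 y1"
      "ereal v2 + ereal (- A2 zb \<bullet> (y2 - xb2)) \<le> \<theta>2 y2"
      "ereal v3 + ereal (- A3 zb \<bullet> (y3 - xb3)) \<le> \<theta>3 y3"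
      using sub unfolding subdifferential_def v1[symmetric] v2[symmetric] v3[symmetric] by blast+
    then have "(ereal v1 + ereal (- A1 zb \<bullet> (y1 - xb1))) + (ereal v2 + ereal (- A2 zb \<bullet> (y2 - xb2)))
        + (ereal v3 + ereal (- A3 zb \<bullet> (y3 - xb3))) + ereal (zb \<bullet> (Astar A1 A2 A3 y1 y2 y3 - c))
      \<le> \<theta>1 y1 + \<theta>2 y2 + \<theta>3 y3 + ereal (zb \<bullet> (Astar A1 A2 A3 y1 y2 y3 - c))"
      by (intro add_mono order_refl)
    \<comment> \<open>Feasibility of the KKT point makes the multiplier term cancel the three linear
      terms, so the subgradient inequalities add up to a saddle-point bound.\<close>
    moreover have "zb \<bullet> (Astar A1 A2 A3 y1 y2 y3 - c)
        = A1 zb \<bullet> (y1 - xb1) + A2 zb \<bullet> (y2 - xb2) + A3 zb \<bullet> (y3 - xb3)"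
      unfolding feas[symmetric] Astar_def
      by (simp add: inner_add_right inner_diff_right linear_A adjoint_works)
    ultimately show ?thesis unfolding lagrangian_def by (simp add: add.assoc)
  qed
  with v1 v2 v3 show thesis by (rule that)
qed

lemma kkt_primal_optimal:
  assumes kkt: "kkt xb1 xb2 xb3 zb"
  shows "primal_optimal \<theta>1 \<theta>2 \<theta>3 A1 A2 A3 c xb1 xb2 xb3"
proof -
  obtain v1 v2 v3 where v: "\<theta>1 xb1 = ereal v1" "\<theta>2 xb2 = ereal v2" "\<theta>3 xb3 = ereal v3"
    and le: "\<And>y1 y2 y3. ereal (v1 + v2 + v3) \<le> lagrangian \<theta>1 \<theta>2 \<theta>3 A1 A2 A3 c y1 y2 y3 zb"
    using kkt_lagrangian[OF kkt] by blast
  have "\<theta>1 xb1 + \<theta>2 xb2 + \<theta>3 xb3 \<le> \<theta>1 y1 + \<theta>2 y2 + \<theta>3 y3"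
    if "Astar A1 A2 A3 y1 y2 y3 = c" for y1 y2 y3
    using le[of y1 y2 y3] that v by (simp add: lagrangian_def flip: zero_ereal_def)
  then show ?thesis using kkt v by (simp add: primal_optimal_def kkt_def eff_dom_def)
qed

lemma kkt_dual_optimal:
  assumes kkt: "kkt xb1 xb2 xb3 zb"
  shows "dual_optimal \<theta>1 \<theta>2 \<theta>3 A1 A2 A3 c zb"
proof -
  obtain v1 v2 v3 where v: "\<theta>1 xb1 = ereal v1" "\<theta>2 xb2 = ereal v2" "\<theta>3 xb3 = ereal v3"
    and le: "\<And>y1 y2 y3. ereal (v1 + v2 + v3) \<le> lagrangian \<theta>1 \<theta>2 \<theta>3 A1 A2 A3 c y1 y2 y3 zb"
    using kkt_lagrangian[OF kkt] by blast
  have lower: "ereal (v1 + v2 + v3) \<le> dual_fun \<theta>1 \<theta>2 \<theta>3 A1 A2 A3 c zb"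
    unfolding dual_fun_def using le by (intro INF_greatest) auto
  \<comment> \<open>Weak duality: at the feasible point the multiplier term vanishes for every
    z'.\<close>
  have upper: "dual_fun \<theta>1 \<theta>2 \<theta>3 A1 A2 A3 c z' \<le> ereal (v1 + v2 + v3)" for z'
  proof -
    have "dual_fun \<theta>1 \<theta>2 \<theta>3 A1 A2 A3 c z' \<le> lagrangian \<theta>1 \<theta>2 \<theta>3 A1 A2 A3 c xb1 xb2 xb3 z'"
      unfolding dual_fun_def by (rule INF_lower2[of "(xb1, xb2, xb3)"]) auto
    also have "\<dots> = ereal (v1 + v2 + v3)" using kkt v by (simp add: lagrangian_def kkt_def)
    finally show ?thesis .
  qed
  have "- \<infinity> < dual_fun \<theta>1 \<theta>2 \<theta>3 A1 A2 A3 c zb"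
    by (rule less_le_trans[OF _ lower]) simp
  then show ?thesis unfolding dual_optimal_def using order_trans[OF upper lower] by blast
qed

lemma linear_Astar: "linear (\<lambda>(y1, y2, y3). Astar A1 A2 A3 y1 y2 y3)"
proof (rule linearI)
  note ladj = linear_A[THEN adjoint_linear]
  fix u v :: "'a \<times> 'b \<times> 'c" and s :: real
  show "(case u + v of (y1, y2, y3) \<Rightarrow> Astar A1 A2 A3 y1 y2 y3) =
    (case u of (y1, y2, y3) \<Rightarrow> Astar A1 A2 A3 y1 y2 y3) +
    (case v of (y1, y2, y3) \<Rightarrow> Astar A1 A2 A3 y1 y2 y3)"
    by (cases u; cases v) (simp add: Astar_def ladj[THEN linear_add])
  show "(case s *\<^sub>R u of (y1, y2, y3) \<Rightarrow> Astar A1 A2 A3 y1 y2 y3) =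
    s *\<^sub>R (case u of (y1, y2, y3) \<Rightarrow> Astar A1 A2 A3 y1 y2 y3)"
    by (cases u) (simp add: Astar_def ladj[THEN linear_cmul] scaleR_add_right)
qed

text \<open>\<open>lagrange_multiplier\<close>, applied to the separable sum on the product space,
  bounds the Lagrangian below by the optimal value. Fixing two blocks at the primal solution turns
  this bound into the subgradient inequality of the third.\<close>

lemma kkt_exists:
  assumes "\<exists>y1 y2 y3. primal_optimal \<theta>1 \<theta>2 \<theta>3 A1 A2 A3 c y1 y2 y3"
    and "\<exists>y1 y2 y3. (y1, y2, y3) \<in> rel_interior (eff_dom \<theta>1 \<times> eff_dom \<theta>2 \<times> eff_dom \<theta>3)
           \<and> Astar A1 A2 A3 y1 y2 y3 = c"
  obtains xb1 xb2 xb3 zb where "kkt xb1 xb2 xb3 zb"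
proof -
  obtain y1 y2 y3 where y: "y1 \<in> eff_dom \<theta>1" "y2 \<in> eff_dom \<theta>2" "y3 \<in> eff_dom \<theta>3"
    and feas: "Astar A1 A2 A3 y1 y2 y3 = c"
    and opt: "\<And>u1 u2 u3. Astar A1 A2 A3 u1 u2 u3 = c \<Longrightarrow>
        \<theta>1 y1 + \<theta>2 y2 + \<theta>3 y3 \<le> \<theta>1 u1 + \<theta>2 u2 + \<theta>3 u3"
    using assms(1) unfolding primal_optimal_def by blast
  obtain s1 s2 s3 where s: "(s1, s2, s3) \<in> rel_interior (eff_dom \<theta>1 \<times> eff_dom \<theta>2 \<times> eff_dom \<theta>3)"
    "Astar A1 A2 A3 s1 s2 s3 = c" using assms(2) by blast
  obtain v1 where v1: "\<theta>1 y1 = ereal v1" using proper_real[OF proper_\<theta>(1) y(1)] .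
  obtain v2 where v2: "\<theta>2 y2 = ereal v2" using proper_real[OF proper_\<theta>(2) y(2)] .
  obtain v3 where v3: "\<theta>3 y3 = ereal v3" using proper_real[OF proper_\<theta>(3) y(3)] .
  define F where "F = (\<lambda>(u1, u2, u3). \<theta>1 u1 + \<theta>2 u2 + \<theta>3 u3)"
  have gt: "- \<infinity> < \<theta>1 u1" "- \<infinity> < \<theta>2 u2" "- \<infinity> < \<theta>3 u3" for u1 u2 u3
    using proper_\<theta> by (auto simp: proper_def)
  have dom: "eff_dom F = eff_dom \<theta>1 \<times> eff_dom \<theta>2 \<times> eff_dom \<theta>3"
    by (auto simp: F_def eff_dom_def)
  have decomp: "\<exists>r1 r2 r3. \<theta>1 u1 = ereal r1 \<and> \<theta>2 u2 = ereal r2 \<and> \<theta>3 u3 = ereal r3 \<and> r1 + r2 + r3 \<le> s"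
    if "F (u1, u2, u3) \<le> ereal s" for u1 u2 u3 s
    using that gt(1)[of u1] gt(2)[of u2] gt(3)[of u3] unfolding F_def
    by (cases "\<theta>1 u1"; cases "\<theta>2 u2"; cases "\<theta>3 u3") auto
  have "- \<infinity> < F (u1, u2, u3)" for u1 u2 u3
    using gt(1)[of u1] gt(2)[of u2] gt(3)[of u3] unfolding F_def
    by (cases "\<theta>1 u1"; cases "\<theta>2 u2"; cases "\<theta>3 u3") auto
  then have "proper F"
    using y unfolding proper_def dom by auto
  moreover have "convex (ereal_epigraph F)"
  proof (rule convexI)
    fix p q :: "('a \<times> 'b \<times> 'c) \<times> real" and a b :: real
    assume p: "p \<in> ereal_epigraph F" and q: "q \<in> ereal_epigraph F" and ab: "0 \<le> a" "0 \<le> b" "a + b = 1"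
    obtain p1 p2 p3 ps where pe: "p = ((p1, p2, p3), ps)" by (metis surj_pair)
    obtain q1 q2 q3 qs where qe: "q = ((q1, q2, q3), qs)" by (metis surj_pair)
    obtain m1 m2 m3 where m: "\<theta>1 p1 = ereal m1" "\<theta>2 p2 = ereal m2" "\<theta>3 p3 = ereal m3"
      "m1 + m2 + m3 \<le> ps" using decomp[of p1 p2 p3 ps] p by (auto simp: ereal_epigraph_def pe)
    obtain n1 n2 n3 where n: "\<theta>1 q1 = ereal n1" "\<theta>2 q2 = ereal n2" "\<theta>3 q3 = ereal n3"
      "n1 + n2 + n3 \<le> qs" using decomp[of q1 q2 q3 qs] q by (auto simp: ereal_epigraph_def qe)
    have "\<theta>1 (a *\<^sub>R p1 + b *\<^sub>R q1) \<le> ereal (a * m1 + b * n1)"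
      "\<theta>2 (a *\<^sub>R p2 + b *\<^sub>R q2) \<le> ereal (a * m2 + b * n2)"
      "\<theta>3 (a *\<^sub>R p3 + b *\<^sub>R q3) \<le> ereal (a * m3 + b * n3)"
      using cpc m n ab unfolding closed_proper_convex_def
      by (auto intro!: convex_ereal_epigraphD)
    then have "F (a *\<^sub>R (p1, p2, p3) + b *\<^sub>R (q1, q2, q3))
      \<le> ereal (a * m1 + b * n1) + ereal (a * m2 + b * n2) + ereal (a * m3 + b * n3)"
      unfolding F_def by (simp del: plus_ereal.simps add: add_mono)
    also have "\<dots> = ereal (a * (m1 + m2 + m3) + b * (n1 + n2 + n3))"
      by (simp add: algebra_simps)
    also have "\<dots> \<le> ereal (a * ps + b * qs)"
      using m(4) n(4) ab unfolding ereal_less_eq(3) by (intro add_mono mult_left_mono) auto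
    finally show "a *\<^sub>R p + b *\<^sub>R q \<in> ereal_epigraph F"
      by (simp add: pe qe ereal_epigraph_def)
  qed
  ultimately obtain zb where zb: "\<And>u. ereal (v1 + v2 + v3) \<le> F u +
      ereal (zb \<bullet> ((\<lambda>(y1, y2, y3). Astar A1 A2 A3 y1 y2 y3) u - c))"
    using lagrange_multiplier[of F "\<lambda>(y1, y2, y3). Astar A1 A2 A3 y1 y2 y3" "(s1, s2, s3)" c "v1 + v2 + v3"]
      linear_Astar s opt v1 v2 v3 unfolding dom by (auto simp: F_def)
  have main: "ereal (v1 + v2 + v3) \<le> \<theta>1 u1 + \<theta>2 u2 + \<theta>3 u3 + ereal (zb \<bullet> (Astar A1 A2 A3 u1 u2 u3 - c))"
    for u1 u2 u3 using zb[of "(u1, u2, u3)"] by (simp add: F_def)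
  have diff: "zb \<bullet> (Astar A1 A2 A3 u1 u2 u3 - c)
      = A1 zb \<bullet> (u1 - y1) + A2 zb \<bullet> (u2 - y2) + A3 zb \<bullet> (u3 - y3)" for u1 u2 u3
    unfolding feas[symmetric] Astar_def
    by (simp add: inner_add_right inner_diff_right linear_A adjoint_works)
  have "- A1 zb \<in> subdifferential \<theta>1 y1"
  proof -
    have "\<theta>1 y1 + ereal (- A1 zb \<bullet> (u - y1)) \<le> \<theta>1 u" for u
      using main[of u y2 y3] unfolding diff v1 v2 v3 by (cases "\<theta>1 u") auto
    then show ?thesis unfolding subdifferential_def by blast
  qed
  moreover have "- A2 zb \<in> subdifferential \<theta>2 y2"
  proof -
    have "\<theta>2 y2 + ereal (- A2 zb \<bullet> (u - y2)) \<le> \<theta>2 u" for u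
      using main[of y1 u y3] unfolding diff v1 v2 v3 by (cases "\<theta>2 u") auto
    then show ?thesis unfolding subdifferential_def by blast
  qed
  moreover have "- A3 zb \<in> subdifferential \<theta>3 y3"
  proof -
    have "\<theta>3 y3 + ereal (- A3 zb \<bullet> (u - y3)) \<le> \<theta>3 u" for u
      using main[of y1 y2 u] unfolding diff v1 v2 v3 by (cases "\<theta>3 u") auto
    then show ?thesis unfolding subdifferential_def by blast
  qed
  ultimately show thesis using that feas unfolding kkt_def by blast
qed

section \<open>Vanishing residuals, boundedness and cluster points\<close>

abbreviation "G \<equiv> \<lambda>v. (1 / 2) *\<^sub>R \<Sigma>1 v + T1 v + \<sigma> *\<^sub>R A1 (adjoint A1 v)"
abbreviation "H \<alpha> \<equiv> H_op \<Sigma>2 \<Sigma>3 T2 T3 A2 A3 \<sigma> \<tau> \<alpha>"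
abbreviation "M \<alpha> \<equiv> M_op \<Sigma>2 \<Sigma>3 T2 T3 A2 A3 \<sigma> \<alpha>"

lemma sqn_G: "sqn G v = 1 / 2 * sqn \<Sigma>1 v + sqn T1 v + \<sigma> * (norm (adjoint A1 v))\<^sup>2"
  by (simp add: sqn_def inner_add_right power2_norm_eq_inner adjoint_clauses(2)[OF linear_A(1)])

text \<open>The Lyapunov function controls x1 only through its \<Sigma>1 and T1 forms. The remaining
  part of \<open>G\<close>, the image under \<open>adjoint A1\<close>, is recovered here from the
  constraint; \<open>adjoint_A1_step\<close> does the same for steps.\<close>

lemma adjoint_A1_error:
  assumes "kkt xb1 xb2 xb3 zb"
  shows "adjoint A1 (x1 k - xb1) = r k - (adjoint A2 (x2 k - xb2) + adjoint A3 (x3 k - xb3))"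
proof -
  have "c = adjoint A1 xb1 + adjoint A2 xb2 + adjoint A3 xb3"
    using assms by (simp add: kkt_def Astar_def)
  then show ?thesis
    unfolding r_def Astar_def linear_A[THEN adjoint_linear, THEN linear_diff] by simp
qed

lemma adjoint_A1_step:
  "adjoint A1 (\<Delta> x1 k) = r (Suc k) - r k - (adjoint A2 (\<Delta> x2 k) + adjoint A3 (\<Delta> x3 k))"
  unfolding r_def Astar_def \<Delta>_def linear_A[THEN adjoint_linear, THEN linear_diff] by simp

text \<open>Every summand is nonnegative, the M-form by hypothesis and the residual term by
  \<open>step_length_coeffs\<close>, so each is bounded by the whole.\<close>

lemma lyapunov_bounds:
  assumes \<alpha>: "0 < \<alpha>" and pM: "pos_def (M \<alpha>)"
  shows "0 \<le> lyapunov \<alpha> xb1 xb2 xb3 zb k"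
    and "inverse (\<sigma> * \<tau>) * (norm (z (Suc k) - zb))\<^sup>2 \<le> lyapunov \<alpha> xb1 xb2 xb3 zb k"
    and "sqn \<Sigma>1 (x1 (Suc k) - xb1) + sqn T1 (x1 (Suc k) - xb1) \<le> lyapunov \<alpha> xb1 xb2 xb3 zb k"
    and "sqn (M \<alpha>) ((x2 (Suc k), x3 (Suc k)) - (xb2, xb3)) \<le> lyapunov \<alpha> xb1 xb2 xb3 zb k"
proof -
  have "0 \<le> inverse (\<sigma> * \<tau>) * (norm (z (Suc k) - zb))\<^sup>2" using \<sigma> \<tau> by simp
  moreover have "0 \<le> sqn \<Sigma>1 (x1 (Suc k) - xb1)" "0 \<le> sqn T1 (x1 (Suc k) - xb1)"
    using psd_\<Sigma>(1) psd_T(1) by (auto intro: sqn_nonneg)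
  moreover have "0 \<le> sqn (M \<alpha>) ((x2 (Suc k), x3 (Suc k)) - (xb2, xb3))"
    using pos_def_psd[OF pM] by (rule sqn_nonneg)
  moreover have "0 \<le> \<kappa> * \<sigma> * (norm (r (Suc k)))\<^sup>2"
    using \<sigma> step_length_coeffs(2)[OF \<tau>] by (intro mult_nonneg_nonneg) auto
  moreover note xi_nonneg[OF \<alpha>, of k]
  moreover have "lyapunov \<alpha> xb1 xb2 xb3 zb k = inverse (\<sigma> * \<tau>) * (norm (z (Suc k) - zb))\<^sup>2
    + (sqn \<Sigma>1 (x1 (Suc k) - xb1) + sqn T1 (x1 (Suc k) - xb1))
    + sqn (M \<alpha>) ((x2 (Suc k), x3 (Suc k)) - (xb2, xb3))
    + \<kappa> * \<sigma> * (norm (r (Suc k)))\<^sup>2 + \<xi> \<alpha> (Suc k)"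
    unfolding lyapunov_def phi_bar_eq_M ..
  ultimately show "0 \<le> lyapunov \<alpha> xb1 xb2 xb3 zb k"
    "inverse (\<sigma> * \<tau>) * (norm (z (Suc k) - zb))\<^sup>2 \<le> lyapunov \<alpha> xb1 xb2 xb3 zb k"
    "sqn \<Sigma>1 (x1 (Suc k) - xb1) + sqn T1 (x1 (Suc k) - xb1) \<le> lyapunov \<alpha> xb1 xb2 xb3 zb k"
    "sqn (M \<alpha>) ((x2 (Suc k), x3 (Suc k)) - (xb2, xb3)) \<le> lyapunov \<alpha> xb1 xb2 xb3 zb k"
    by - (linarith+)
qed

text \<open>Nonnegativity of the residual term rests on \<open>mu_positive\<close>, hence on the
  upper bound for \<tau>, and that of the step term on the positive definiteness of
  \<open>H\<close>. Together they make the Lyapunov function monotone.\<close>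

lemma decrement_bounds:
  assumes \<tau>': "\<tau> < (1 + sqrt 5) / 2" and pH: "pos_def (H \<alpha>)"
  shows "0 \<le> decrement \<alpha> k"
    and "\<mu> * \<sigma> * inverse \<tau> * (norm (r (Suc (Suc k))))\<^sup>2 \<le> decrement \<alpha> k"
    and "1 / 2 * sqn \<Sigma>1 (\<Delta> x1 (Suc k)) + sqn T1 (\<Delta> x1 (Suc k)) \<le> decrement \<alpha> k"
    and "sqn (H \<alpha>) (\<Delta> (\<lambda>j. (x2 j, x3 j)) (Suc k)) \<le> decrement \<alpha> k"
proof -
  have "0 \<le> \<mu> * \<sigma> * inverse \<tau> * (norm (r (Suc (Suc k))))\<^sup>2"
    using mu_positive[OF \<tau>'] \<sigma> \<tau> by (intro mult_nonneg_nonneg) auto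
  moreover have "0 \<le> sqn \<Sigma>1 (\<Delta> x1 (Suc k))" "0 \<le> sqn T1 (\<Delta> x1 (Suc k))"
    using psd_\<Sigma>(1) psd_T(1) by (auto intro: sqn_nonneg)
  moreover have "0 \<le> sqn (H \<alpha>) (\<Delta> (\<lambda>j. (x2 j, x3 j)) (Suc k))"
    using pos_def_psd[OF pH] by (rule sqn_nonneg)
  moreover have "decrement \<alpha> k = 1 / 2 * sqn \<Sigma>1 (\<Delta> x1 (Suc k)) + sqn T1 (\<Delta> x1 (Suc k))
    + sqn (H \<alpha>) (\<Delta> (\<lambda>j. (x2 j, x3 j)) (Suc k))
    + \<mu> * \<sigma> * inverse \<tau> * (norm (r (Suc (Suc k))))\<^sup>2"
    unfolding decrement_def t_seq_Suc_H ..
  ultimately show "0 \<le> decrement \<alpha> k"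
    "\<mu> * \<sigma> * inverse \<tau> * (norm (r (Suc (Suc k))))\<^sup>2 \<le> decrement \<alpha> k"
    "1 / 2 * sqn \<Sigma>1 (\<Delta> x1 (Suc k)) + sqn T1 (\<Delta> x1 (Suc k)) \<le> decrement \<alpha> k"
    "sqn (H \<alpha>) (\<Delta> (\<lambda>j. (x2 j, x3 j)) (Suc k)) \<le> decrement \<alpha> k"
    by - (linarith+)
qed

lemma decseq_lyapunov:
  assumes "kkt xb1 xb2 xb3 zb" "0 < \<alpha>" "\<alpha> \<le> 1"
    and "\<tau> < (1 + sqrt 5) / 2" "pos_def (H \<alpha>)"
  shows "decseq (lyapunov \<alpha> xb1 xb2 xb3 zb)"
proof (rule decseq_SucI)
  fix k
  show "lyapunov \<alpha> xb1 xb2 xb3 zb (Suc k) \<le> lyapunov \<alpha> xb1 xb2 xb3 zb k"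
    using lyapunov_decrease[OF assms(1-3), of k] decrement_bounds(1)[OF assms(4,5), of k] by linarith
qed

text \<open>Consecutive differences of the convergent Lyapunov sequence tend to 0 and dominate the
  decrement.\<close>

lemma decrement_tendsto_0:
  assumes kkt: "kkt xb1 xb2 xb3 zb" and \<alpha>: "0 < \<alpha>" "\<alpha> \<le> 1"
    and \<tau>': "\<tau> < (1 + sqrt 5) / 2" and pH: "pos_def (H \<alpha>)" and pM: "pos_def (M \<alpha>)"
  shows "decrement \<alpha> \<longlonglongrightarrow> 0"
proof -
  let ?L = "lyapunov \<alpha> xb1 xb2 xb3 zb"
  have "convergent ?L"
    by (rule decseq_nonneg_convergent[OF decseq_lyapunov[OF kkt \<alpha> \<tau>' pH] lyapunov_bounds(1)[OF \<alpha>(1) pM]])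
  then obtain l where l: "?L \<longlonglongrightarrow> l" unfolding convergent_def by (elim exE)
  have "(\<lambda>k. ?L k - ?L (Suc k)) \<longlonglongrightarrow> l - l" by (intro tendsto_diff l LIMSEQ_Suc)
  moreover have "decrement \<alpha> k \<le> ?L k - ?L (Suc k)" for k
    using lyapunov_decrease[OF kkt \<alpha>, of k] by linarith
  ultimately show ?thesis
    by (intro squeeze_0[of "decrement \<alpha>"] decrement_bounds(1)[OF \<tau>' pH]) simp_all
qed

text \<open>The decrement yields the residual and, through \<open>H\<close>, the steps of x2 and x3.
  Only then is the step of x1 known to vanish under \<open>adjoint A1\<close>, which completes the
  form of \<open>G\<close>.\<close>

lemma residuals_tendsto_0:
  assumes D: "decrement \<alpha> \<longlonglongrightarrow> 0" and \<tau>': "\<tau> < (1 + sqrt 5) / 2"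
    and pG: "pos_def G" and pH: "pos_def (H \<alpha>)"
  shows "r \<longlonglongrightarrow> 0" "\<Delta> x1 \<longlonglongrightarrow> 0" "\<Delta> x2 \<longlonglongrightarrow> 0" "\<Delta> x3 \<longlonglongrightarrow> 0"
proof -
  have "0 < \<mu> * \<sigma> * inverse \<tau>" using mu_positive[OF \<tau>'] \<sigma> \<tau> by (intro mult_pos_pos) auto
  then have "(\<lambda>k. r (Suc (Suc k))) \<longlonglongrightarrow> 0"
    by (rule coercive_tendsto_0[OF _ _ D]) (rule decrement_bounds(2)[OF \<tau>' pH])
  then show r: "r \<longlonglongrightarrow> 0"
    unfolding filterlim_sequentially_Suc[of "\<lambda>k. r (Suc k)"] filterlim_sequentially_Suc .
  have "(\<lambda>k. sqn (H \<alpha>) (\<Delta> (\<lambda>j. (x2 j, x3 j)) (Suc k))) \<longlonglongrightarrow> 0"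
    by (rule squeeze_0[OF _ _ D])
      (rule sqn_nonneg[OF pos_def_psd[OF pH]], rule decrement_bounds(4)[OF \<tau>' pH])
  then have u: "(\<lambda>k. \<Delta> (\<lambda>j. (x2 j, x3 j)) (Suc k)) \<longlonglongrightarrow> 0"
    by (rule pos_def_tendsto_0[OF pH])
  have "(\<lambda>k. \<Delta> x2 (Suc k)) \<longlonglongrightarrow> 0" "(\<lambda>k. \<Delta> x3 (Suc k)) \<longlonglongrightarrow> 0"
    using tendsto_fst[OF u] tendsto_snd[OF u] by (simp_all add: \<Delta>_def)
  then show x2: "\<Delta> x2 \<longlonglongrightarrow> 0" and x3: "\<Delta> x3 \<longlonglongrightarrow> 0"
    unfolding filterlim_sequentially_Suc by auto
  note ladj = linear_A[THEN adjoint_linear]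
  have "(\<lambda>k. adjoint A1 (\<Delta> x1 k)) \<longlonglongrightarrow> 0 - 0 - (0 + 0)"
    unfolding adjoint_A1_step
    by (intro tendsto_diff tendsto_add LIMSEQ_Suc[OF r] r linear_tendsto_0[OF ladj(2) x2]
        linear_tendsto_0[OF ladj(3) x3])
  then have "(\<lambda>k. adjoint A1 (\<Delta> x1 (Suc k))) \<longlonglongrightarrow> 0"
    unfolding filterlim_sequentially_Suc[of "\<lambda>k. adjoint A1 (\<Delta> x1 k)"] by simp
  then have a: "(\<lambda>k. \<sigma> * (norm (adjoint A1 (\<Delta> x1 (Suc k))))\<^sup>2) \<longlonglongrightarrow> 0"
    by (intro tendsto_mult_right_zero) (simp add: tendsto_norm_zero)
  have b: "(\<lambda>k. 1 / 2 * sqn \<Sigma>1 (\<Delta> x1 (Suc k)) + sqn T1 (\<Delta> x1 (Suc k))) \<longlonglongrightarrow> 0"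
    by (rule squeeze_0[OF _ _ D])
      (simp add: sqn_nonneg psd_\<Sigma>(1) psd_T(1), rule decrement_bounds(3)[OF \<tau>' pH])
  have "(\<lambda>k. sqn G (\<Delta> x1 (Suc k))) \<longlonglongrightarrow> 0"
    unfolding sqn_G using tendsto_add[OF b a] by simp
  then have "(\<lambda>k. \<Delta> x1 (Suc k)) \<longlonglongrightarrow> 0" by (rule pos_def_tendsto_0[OF pG])
  then show "\<Delta> x1 \<longlonglongrightarrow> 0" unfolding filterlim_sequentially_Suc .
qed

text \<open>The Lyapunov function bounds z and, through \<open>M\<close>, the pair of x2 and x3
  directly. For x1 the constraint bounds the \<open>adjoint A1\<close> part of \<open>G\<close>, as
  r converges.\<close>

lemma iterates_bounded:
  assumes kkt: "kkt xb1 xb2 xb3 zb" and \<alpha>: "0 < \<alpha>" "\<alpha> \<le> 1"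
    and \<tau>': "\<tau> < (1 + sqrt 5) / 2" and pG: "pos_def G" and pH: "pos_def (H \<alpha>)"
    and pM: "pos_def (M \<alpha>)" and r: "r \<longlonglongrightarrow> 0"
  shows "bounded (range (\<lambda>k. (x1 (Suc k), x2 (Suc k), x3 (Suc k), z (Suc k))))"
proof -
  let ?L = "lyapunov \<alpha> xb1 xb2 xb3 zb"
  note ladj = linear_A[THEN adjoint_linear]
  have L0: "?L k \<le> ?L 0" for k using decseqD[OF decseq_lyapunov[OF kkt \<alpha> \<tau>' pH], of 0 k] by simp
  note bound = order_trans[OF _ L0]
  have bz: "bounded (range (\<lambda>k. z (Suc k)))"
    by (rule coercive_bounded[of "inverse (\<sigma> * \<tau>)"])
      (use \<sigma> \<tau> in simp, rule bound[OF lyapunov_bounds(2)[OF \<alpha>(1) pM]])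
  have bu: "bounded (range (\<lambda>k. (x2 (Suc k), x3 (Suc k))))"
    by (rule pos_def_bounded[OF pM]) (rule bound[OF lyapunov_bounds(4)[OF \<alpha>(1) pM]])
  have b2: "bounded (range (\<lambda>k. x2 (Suc k)))" and b3: "bounded (range (\<lambda>k. x3 (Suc k)))"
    using bounded_fst[OF bu] bounded_snd[OF bu] by (simp_all add: image_image)
  have c2: "bounded (range (\<lambda>k. x2 (Suc k) - xb2))" and c3: "bounded (range (\<lambda>k. x3 (Suc k) - xb3))"
    using b2 b3 by (intro bounded_minus_comp; simp add: image_constant_conv)+
  have "bounded (range (\<lambda>k. r (Suc k)))"
    using convergent_imp_bounded[OF LIMSEQ_Suc[OF r]] .
  then have "bounded (range (\<lambda>k. adjoint A1 (x1 (Suc k) - xb1)))"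
    unfolding adjoint_A1_error[OF kkt]
    by (intro bounded_minus_comp bounded_plus_comp bounded_range_linear[OF ladj(2) c2]
        bounded_range_linear[OF ladj(3) c3])
  then obtain R where R: "\<And>k. norm (adjoint A1 (x1 (Suc k) - xb1)) \<le> R"
    unfolding bounded_iff by blast
  have "sqn G (x1 (Suc k) - xb1) \<le> ?L 0 + \<sigma> * R\<^sup>2" for k
  proof -
    have "\<sigma> * (norm (adjoint A1 (x1 (Suc k) - xb1)))\<^sup>2 \<le> \<sigma> * R\<^sup>2"
      using \<sigma> R by (intro mult_left_mono power_mono) auto
    \<comment> \<open>The Lyapunov function bounds the full \<Sigma>1 form, of which
      \<open>G\<close> takes half.\<close>
    moreover have "0 \<le> sqn \<Sigma>1 (x1 (Suc k) - xb1)" using psd_\<Sigma>(1) by (rule sqn_nonneg)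
    ultimately show ?thesis
      using bound[OF lyapunov_bounds(3)[OF \<alpha>(1) pM], of k] unfolding sqn_G
      by linarith
  qed
  then have b1: "bounded (range (\<lambda>k. x1 (Suc k)))" by (rule pos_def_bounded[OF pG])
  have "bounded (range (\<lambda>k. x1 (Suc k)) \<times> range (\<lambda>k. x2 (Suc k)) \<times> range (\<lambda>k. x3 (Suc k))
      \<times> range (\<lambda>k. z (Suc k)))"
    by (intro bounded_Times b1 b2 b3 bz)
  then show ?thesis by (rule bounded_subset) auto
qed

text \<open>The subgradients at \<open>Suc (\<rho> j)\<close> carry the multiplier z at
  \<open>\<rho> j\<close>. Since the steps vanish, the primal iterates at both indices share their
  limit, and all correction terms in the subgradients tend to 0.\<close>

lemma cluster_point_kkt:
  assumes \<rho>: "strict_mono \<rho>"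
    and lim: "(\<lambda>j. x1 (\<rho> j)) \<longlonglongrightarrow> xs1" "(\<lambda>j. x2 (\<rho> j)) \<longlonglongrightarrow> xs2" "(\<lambda>j. x3 (\<rho> j)) \<longlonglongrightarrow> xs3"
      "(\<lambda>j. z (\<rho> j)) \<longlonglongrightarrow> zs"
    and r: "r \<longlonglongrightarrow> 0" and d: "\<Delta> x1 \<longlonglongrightarrow> 0" "\<Delta> x2 \<longlonglongrightarrow> 0" "\<Delta> x3 \<longlonglongrightarrow> 0"
  shows "kkt xs1 xs2 xs3 zs"
proof -
  note ladj = linear_A[THEN adjoint_linear]
  have lim': "(\<lambda>j. x1 (Suc (\<rho> j))) \<longlonglongrightarrow> xs1" "(\<lambda>j. x2 (Suc (\<rho> j))) \<longlonglongrightarrow> xs2"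
    "(\<lambda>j. x3 (Suc (\<rho> j))) \<longlonglongrightarrow> xs3"
    using tendsto_add[OF lim(1) LIMSEQ_subseq_LIMSEQ[OF d(1) \<rho>]]
      tendsto_add[OF lim(2) LIMSEQ_subseq_LIMSEQ[OF d(2) \<rho>]]
      tendsto_add[OF lim(3) LIMSEQ_subseq_LIMSEQ[OF d(3) \<rho>]]
    by (simp_all add: \<Delta>_def o_def)
  have r\<rho>: "(\<lambda>j. r (\<rho> j)) \<longlonglongrightarrow> 0" and rS: "(\<lambda>j. r (Suc (\<rho> j))) \<longlonglongrightarrow> 0"
    using LIMSEQ_subseq_LIMSEQ[OF r \<rho>] LIMSEQ_subseq_LIMSEQ[OF LIMSEQ_Suc[OF r] \<rho>]
    by (simp_all add: o_def)
  have dd: "(\<lambda>j. \<Delta> x1 (\<rho> j)) \<longlonglongrightarrow> 0" "(\<lambda>j. \<Delta> x2 (\<rho> j)) \<longlonglongrightarrow> 0" "(\<lambda>j. \<Delta> x3 (\<rho> j)) \<longlonglongrightarrow> 0"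
    using LIMSEQ_subseq_LIMSEQ[OF d(1) \<rho>] LIMSEQ_subseq_LIMSEQ[OF d(2) \<rho>]
      LIMSEQ_subseq_LIMSEQ[OF d(3) \<rho>] by (simp_all add: o_def)
  have a2: "(\<lambda>j. adjoint A2 (\<Delta> x2 (\<rho> j))) \<longlonglongrightarrow> 0" and a3: "(\<lambda>j. adjoint A3 (\<Delta> x3 (\<rho> j))) \<longlonglongrightarrow> 0"
    by (rule linear_tendsto_0[OF ladj(2) dd(2)], rule linear_tendsto_0[OF ladj(3) dd(3)])
  have "(\<lambda>j. - (A1 (z (\<rho> j) + \<sigma> *\<^sub>R (r (Suc (\<rho> j)) - adjoint A2 (\<Delta> x2 (\<rho> j)) - adjoint A3 (\<Delta> x3 (\<rho> j))))
      + T1 (\<Delta> x1 (\<rho> j)))) \<longlonglongrightarrow> - (A1 (zs + \<sigma> *\<^sub>R (0 - 0 - 0)) + 0)"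
    by (intro tendsto_minus tendsto_add tendsto_diff tendsto_scaleR tendsto_const lim(4) rS a2 a3
        linear_tendsto[OF linear_A(1)] linear_tendsto_0[OF psdD(1)[OF psd_T(1)] dd(1)])
  then have "- (A1 (zs + \<sigma> *\<^sub>R (0 - 0 - 0)) + 0) \<in> subdifferential \<theta>1 xs1"
    by (rule subdifferential_closed_graph[OF cpc(1) _ lim'(1), rotated]) (rule iterate_subgradients(1))
  then have k1: "- A1 zs \<in> subdifferential \<theta>1 xs1" by simp
  have "(\<lambda>j. - (A2 (z (\<rho> j) + \<sigma> *\<^sub>R (r (Suc (\<rho> j)) - adjoint A3 (\<Delta> x3 (\<rho> j))))
      + T2 (\<Delta> x2 (\<rho> j)))) \<longlonglongrightarrow> - (A2 (zs + \<sigma> *\<^sub>R (0 - 0)) + 0)"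
    by (intro tendsto_minus tendsto_add tendsto_diff tendsto_scaleR tendsto_const lim(4) rS a3
        linear_tendsto[OF linear_A(2)] linear_tendsto_0[OF psdD(1)[OF psd_T(2)] dd(2)])
  then have "- (A2 (zs + \<sigma> *\<^sub>R (0 - 0)) + 0) \<in> subdifferential \<theta>2 xs2"
    by (rule subdifferential_closed_graph[OF cpc(2) _ lim'(2), rotated]) (rule iterate_subgradients(2))
  then have k2: "- A2 zs \<in> subdifferential \<theta>2 xs2" by simp
  have "(\<lambda>j. - (A3 (z (\<rho> j) + \<sigma> *\<^sub>R r (Suc (\<rho> j))) + T3 (\<Delta> x3 (\<rho> j))))
      \<longlonglongrightarrow> - (A3 (zs + \<sigma> *\<^sub>R 0) + 0)"
    by (intro tendsto_minus tendsto_add tendsto_scaleR tendsto_const lim(4) rS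
        linear_tendsto[OF linear_A(3)] linear_tendsto_0[OF psdD(1)[OF psd_T(3)] dd(3)])
  then have "- (A3 (zs + \<sigma> *\<^sub>R 0) + 0) \<in> subdifferential \<theta>3 xs3"
    by (rule subdifferential_closed_graph[OF cpc(3) _ lim'(3), rotated]) (rule iterate_subgradients(3))
  then have k3: "- A3 zs \<in> subdifferential \<theta>3 xs3" by simp
  have "(\<lambda>j. r (\<rho> j)) \<longlonglongrightarrow> Astar A1 A2 A3 xs1 xs2 xs3 - c"
    unfolding r_def Astar_def
    by (intro tendsto_diff tendsto_add tendsto_const linear_tendsto[OF ladj(1) lim(1)]
        linear_tendsto[OF ladj(2) lim(2)] linear_tendsto[OF ladj(3) lim(3)])
  then have "Astar A1 A2 A3 xs1 xs2 xs3 - c = 0" using r\<rho> LIMSEQ_unique by blast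
  with k1 k2 k3 show ?thesis by (simp add: kkt_def)
qed

lemma convergence:
  assumes kkt: "kkt y1 y2 y3 y" and \<alpha>: "0 < \<alpha>" "\<alpha> \<le> 1"
    and \<tau>': "\<tau> < (1 + sqrt 5) / 2" and pG: "pos_def G" and pH: "pos_def (H \<alpha>)"
    and pM: "pos_def (M \<alpha>)"
  obtains xs1 xs2 xs3 zs where "kkt xs1 xs2 xs3 zs"
    "x1 \<longlonglongrightarrow> xs1" "x2 \<longlonglongrightarrow> xs2" "x3 \<longlonglongrightarrow> xs3" "z \<longlonglongrightarrow> zs"
proof -
  note ladj = linear_A[THEN adjoint_linear]
  have D: "decrement \<alpha> \<longlonglongrightarrow> 0" by (rule decrement_tendsto_0[OF kkt \<alpha> \<tau>' pH pM])
  note res = residuals_tendsto_0[OF D \<tau>' pG pH]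
  let ?w = "\<lambda>k. (x1 (Suc k), x2 (Suc k), x3 (Suc k), z (Suc k))"
  obtain l \<rho> where \<rho>: "strict_mono \<rho>" and l: "(?w \<circ> \<rho>) \<longlonglongrightarrow> l"
    using bounded_imp_convergent_subsequence[OF iterates_bounded[OF kkt \<alpha> \<tau>' pG pH pM res(1)]] by blast
  obtain xs1 xs2 xs3 zs where le: "l = (xs1, xs2, xs3, zs)" by (cases l)
  have lim: "(\<lambda>j. x1 (Suc (\<rho> j))) \<longlonglongrightarrow> xs1" "(\<lambda>j. x2 (Suc (\<rho> j))) \<longlonglongrightarrow> xs2"
    "(\<lambda>j. x3 (Suc (\<rho> j))) \<longlonglongrightarrow> xs3" "(\<lambda>j. z (Suc (\<rho> j))) \<longlonglongrightarrow> zs"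
    using l tendsto_fst[OF l] tendsto_fst[OF tendsto_snd[OF l]]
      tendsto_fst[OF tendsto_snd[OF tendsto_snd[OF l]]] tendsto_snd[OF tendsto_snd[OF tendsto_snd[OF l]]]
    by (simp_all add: o_def le)
  have "strict_mono (\<lambda>j. Suc (\<rho> j))" using \<rho> by (auto simp: strict_mono_def)
  from cluster_point_kkt[OF this lim res] have kkt': "kkt xs1 xs2 xs3 zs" .
  \<comment> \<open>The Lyapunov function is now centred at the cluster point, where it is monotone
    because that point is a KKT point.\<close>
  let ?L = "lyapunov \<alpha> xs1 xs2 xs3 zs"
  have linM: "linear (M \<alpha>)" using pM by (simp add: pos_def_def self_adjoint_def)
  have linX: "linear X" by (rule linear_cross_op[OF pos_def_\<Sigma>2 linear_A(2,3)])
  have sub: "(\<lambda>j. \<Delta> x2 (\<rho> j)) \<longlonglongrightarrow> 0" "(\<lambda>j. \<Delta> x3 (\<rho> j)) \<longlonglongrightarrow> 0" "(\<lambda>j. r (Suc (\<rho> j))) \<longlonglongrightarrow> 0"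
    using LIMSEQ_subseq_LIMSEQ[OF res(3) \<rho>] LIMSEQ_subseq_LIMSEQ[OF res(4) \<rho>]
      LIMSEQ_subseq_LIMSEQ[OF LIMSEQ_Suc[OF res(1)] \<rho>] by (simp_all add: o_def)
  have u: "(\<lambda>j. (x2 (Suc (\<rho> j)), x3 (Suc (\<rho> j))) - (xs2, xs3)) \<longlonglongrightarrow> 0"
    using tendsto_diff[OF tendsto_Pair[OF lim(2,3)] tendsto_const[of "(xs2, xs3)"]] by simp
  \<comment> \<open>The errors vanish along \<rho> by the choice of the subsequence, the residual
    and the differences in \<open>\<xi>\<close> along the whole sequence.\<close>
  have "(\<lambda>j. ?L (\<rho> j)) \<longlonglongrightarrow> inverse (\<sigma> * \<tau>) * (norm (0::'z))\<^sup>2 + (0 + 0) + 0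
      + \<kappa> * \<sigma> * (norm (0::'z))\<^sup>2 + (0 + 0 + \<sigma>\<^sup>2 / \<alpha> * 0)"
    unfolding lyapunov_def phi_bar_eq_M xi_Suc
    by (intro tendsto_add tendsto_mult tendsto_const tendsto_power tendsto_norm sub
        sqn_tendsto_0 psdD(1)[OF psd_\<Sigma>(1)] psdD(1)[OF psd_T(1)] psdD(1)[OF psd_T(2)]
        psdD(1)[OF psd_T(3)] linM linX lim[THEN LIM_zero] u)
  then have "(?L \<circ> \<rho>) \<longlonglongrightarrow> 0" by (simp add: o_def)
  then have L: "?L \<longlonglongrightarrow> 0"
    by (rule decseq_tendsto_0_subseq[OF decseq_lyapunov[OF kkt' \<alpha> \<tau>' pH] _ \<rho>, rotated])
      (rule lyapunov_bounds(1)[OF \<alpha>(1) pM])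
  have "0 < inverse (\<sigma> * \<tau>)" using \<sigma> \<tau> by simp
  then have "(\<lambda>k. z (Suc k) - zs) \<longlonglongrightarrow> 0"
    by (rule coercive_tendsto_0[OF _ _ L]) (rule lyapunov_bounds(2)[OF \<alpha>(1) pM])
  then have zlim: "z \<longlonglongrightarrow> zs" by (simp add: LIM_zero_iff filterlim_sequentially_Suc)
  have "(\<lambda>k. sqn (M \<alpha>) ((x2 (Suc k), x3 (Suc k)) - (xs2, xs3))) \<longlonglongrightarrow> 0"
    by (rule squeeze_0[OF _ _ L])
      (rule sqn_nonneg[OF pos_def_psd[OF pM]], rule lyapunov_bounds(4)[OF \<alpha>(1) pM])
  then have ulim: "(\<lambda>k. (x2 (Suc k), x3 (Suc k)) - (xs2, xs3)) \<longlonglongrightarrow> 0"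
    by (rule pos_def_tendsto_0[OF pM])
  have e2: "(\<lambda>k. x2 (Suc k) - xs2) \<longlonglongrightarrow> 0" and e3: "(\<lambda>k. x3 (Suc k) - xs3) \<longlonglongrightarrow> 0"
    using tendsto_fst[OF ulim] tendsto_snd[OF ulim] by simp_all
  have "(\<lambda>k. adjoint A1 (x1 (Suc k) - xs1)) \<longlonglongrightarrow> 0 - (0 + 0)"
    unfolding adjoint_A1_error[OF kkt']
    by (intro tendsto_diff tendsto_add LIMSEQ_Suc[OF res(1)] linear_tendsto_0[OF ladj(2) e2]
        linear_tendsto_0[OF ladj(3) e3])
  then have a: "(\<lambda>k. \<sigma> * (norm (adjoint A1 (x1 (Suc k) - xs1)))\<^sup>2) \<longlonglongrightarrow> 0"
    by (intro tendsto_mult_right_zero) (simp add: tendsto_norm_zero)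
  have b: "(\<lambda>k. 1 / 2 * sqn \<Sigma>1 (x1 (Suc k) - xs1) + sqn T1 (x1 (Suc k) - xs1)) \<longlonglongrightarrow> 0"
  proof (rule squeeze_0[OF _ _ L])
    fix k
    show "0 \<le> 1 / 2 * sqn \<Sigma>1 (x1 (Suc k) - xs1) + sqn T1 (x1 (Suc k) - xs1)"
      using sqn_nonneg[OF psd_\<Sigma>(1)] sqn_nonneg[OF psd_T(1)] by simp
    show "1 / 2 * sqn \<Sigma>1 (x1 (Suc k) - xs1) + sqn T1 (x1 (Suc k) - xs1) \<le> ?L k"
      using lyapunov_bounds(3)[OF \<alpha>(1) pM, of k xs1 xs2 xs3 zs]
        sqn_nonneg[OF psd_\<Sigma>(1), of "x1 (Suc k) - xs1"] by linarith
  qed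
  have "(\<lambda>k. sqn G (x1 (Suc k) - xs1)) \<longlonglongrightarrow> 0"
    unfolding sqn_G using tendsto_add[OF b a] by simp
  then have e1: "(\<lambda>k. x1 (Suc k) - xs1) \<longlonglongrightarrow> 0" by (rule pos_def_tendsto_0[OF pG])
  show thesis
  proof (rule that[OF kkt'])
    show "x1 \<longlonglongrightarrow> xs1" "x2 \<longlonglongrightarrow> xs2" "x3 \<longlonglongrightarrow> xs3"
      using e1 e2 e3 by (simp_all add: LIM_zero_iff filterlim_sequentially_Suc)
  qed (rule zlim)
qed

end

theorem theorem2p1:
  fixes \<theta>1 :: "'a::euclidean_space \<Rightarrow> ereal"
    and \<theta>2 :: "'b::euclidean_space \<Rightarrow> ereal"
    and \<theta>3 :: "'c::euclidean_space \<Rightarrow> ereal"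
    and A1 :: "'z::euclidean_space \<Rightarrow> 'a" and A2 :: "'z \<Rightarrow> 'b" and A3 :: "'z \<Rightarrow> 'c"
    and c :: 'z
    and \<Sigma>1 T1 :: "'a \<Rightarrow> 'a" and \<Sigma>2 T2 :: "'b \<Rightarrow> 'b" and \<Sigma>3 T3 :: "'c \<Rightarrow> 'c"
    and \<sigma> \<tau> :: real
    and x1 :: "nat \<Rightarrow> 'a" and x2 :: "nat \<Rightarrow> 'b" and x3 :: "nat \<Rightarrow> 'c" and z :: "nat \<Rightarrow> 'z"
  assumes "closed_proper_convex \<theta>1" "closed_proper_convex \<theta>2" "closed_proper_convex \<theta>3"
    and "linear A1" "linear A2" "linear A3"
    and "\<exists>y1 y2 y3. primal_optimal \<theta>1 \<theta>2 \<theta>3 A1 A2 A3 c y1 y2 y3"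
    and "psd \<Sigma>1" "psd \<Sigma>2" "psd \<Sigma>3"
    and "monotone_modulus \<theta>1 \<Sigma>1" "monotone_modulus \<theta>2 \<Sigma>2" "monotone_modulus \<theta>3 \<Sigma>3"
    and "psd T1" "psd T2" "psd T3"
    and "\<sigma> > 0" "\<tau> > 0"
    and "pos_def \<Sigma>2"
    and "sPADMM \<theta>1 \<theta>2 \<theta>3 A1 A2 A3 c T1 T2 T3 \<sigma> \<tau> x1 x2 x3 z"
    and "\<exists>y1 y2 y3. (y1, y2, y3) \<in> rel_interior (eff_dom \<theta>1 \<times> eff_dom \<theta>2 \<times> eff_dom \<theta>3)
           \<and> Astar A1 A2 A3 y1 y2 y3 = c"
  shows
    "(\<forall>\<alpha> xb1 xb2 xb3 zb.
        0 < \<alpha> \<and> \<alpha> \<le> 1 \<and>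
        - A1 zb \<in> subdifferential \<theta>1 xb1 \<and>
        - A2 zb \<in> subdifferential \<theta>2 xb2 \<and>
        - A3 zb \<in> subdifferential \<theta>3 xb3 \<and>
        Astar A1 A2 A3 xb1 xb2 xb3 - c = 0 \<longrightarrow>
        (let \<phi> = phi_bar \<Sigma>1 \<Sigma>2 \<Sigma>3 T1 T2 T3 A2 A3 \<sigma> \<tau> \<alpha> xb1 xb2 xb3 zb x1 x2 x3 z;
             \<xi> = xi \<Sigma>2 T2 T3 A2 A3 \<sigma> \<alpha> x2 x3;
             t = t_seq \<Sigma>1 \<Sigma>2 \<Sigma>3 T1 T2 T3 A2 A3 \<sigma> \<tau> \<alpha> x1 x2 x3;
             r = (\<lambda>k. Astar A1 A2 A3 (x1 k) (x2 k) (x3 k) - c)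
         in \<forall>k\<ge>1.
              (\<phi> k + max (1 - \<tau>) (1 - inverse \<tau>) * \<sigma> * (norm (r k))\<^sup>2 + \<xi> k)
              - (\<phi> (k + 1) + max (1 - \<tau>) (1 - inverse \<tau>) * \<sigma> * (norm (r (k + 1)))\<^sup>2 + \<xi> (k + 1))
              \<ge> t (k + 1) + min \<tau> (1 + \<tau> - \<tau>\<^sup>2) * \<sigma> * inverse \<tau> * (norm (r (k + 1)))\<^sup>2))
     \<and>
     (\<tau> < (1 + sqrt 5) / 2 \<and>
      (\<exists>\<alpha>. 0 < \<alpha> \<and> \<alpha> \<le> 1 \<and>
         pos_def (\<lambda>v. (1 / 2) *\<^sub>R \<Sigma>1 v + T1 v + \<sigma> *\<^sub>R A1 (adjoint A1 v)) \<and>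
         pos_def (H_op \<Sigma>2 \<Sigma>3 T2 T3 A2 A3 \<sigma> \<tau> \<alpha>) \<and>
         pos_def (M_op \<Sigma>2 \<Sigma>3 T2 T3 A2 A3 \<sigma> \<alpha>)) \<longrightarrow>
      (\<exists>xs1 xs2 xs3. primal_optimal \<theta>1 \<theta>2 \<theta>3 A1 A2 A3 c xs1 xs2 xs3 \<and>
         (\<lambda>k. (x1 k, x2 k, x3 k)) \<longlonglongrightarrow> (xs1, xs2, xs3)) \<and>
      (\<exists>zs. dual_optimal \<theta>1 \<theta>2 \<theta>3 A1 A2 A3 c zs \<and> z \<longlonglongrightarrow> zs))"
proof -
  interpret spadmm_run \<theta>1 \<theta>2 \<theta>3 A1 A2 A3 c \<Sigma>1 T1 \<Sigma>2 T2 \<Sigma>3 T3 \<sigma> \<tau> x1 x2 x3 z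
    by (rule spadmm_run.intro) (fact assms)+
  have a: "(\<phi> \<alpha> xb1 xb2 xb3 zb k + \<kappa> * \<sigma> * (norm (r k))\<^sup>2 + \<xi> \<alpha> k)
      - (\<phi> \<alpha> xb1 xb2 xb3 zb (k + 1) + \<kappa> * \<sigma> * (norm (r (k + 1)))\<^sup>2 + \<xi> \<alpha> (k + 1))
    \<ge> t \<alpha> (k + 1) + \<mu> * \<sigma> * inverse \<tau> * (norm (r (k + 1)))\<^sup>2"
    if asm: "0 < \<alpha>" "\<alpha> \<le> 1" "- A1 zb \<in> subdifferential \<theta>1 xb1" "- A2 zb \<in> subdifferential \<theta>2 xb2"
      "- A3 zb \<in> subdifferential \<theta>3 xb3" "Astar A1 A2 A3 xb1 xb2 xb3 - c = 0" "k \<ge> 1"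
    for \<alpha> xb1 xb2 xb3 zb k
  proof -
    obtain j where j: "k = Suc j" using asm(7) by (cases k) auto
    have "kkt xb1 xb2 xb3 zb" using asm by (simp add: kkt_def)
    from descent[OF this asm(1,2), of j] show ?thesis by (simp add: j)
  qed
  have b: "(\<exists>xs1 xs2 xs3. primal_optimal \<theta>1 \<theta>2 \<theta>3 A1 A2 A3 c xs1 xs2 xs3 \<and>
         (\<lambda>k. (x1 k, x2 k, x3 k)) \<longlonglongrightarrow> (xs1, xs2, xs3)) \<and>
      (\<exists>zs. dual_optimal \<theta>1 \<theta>2 \<theta>3 A1 A2 A3 c zs \<and> z \<longlonglongrightarrow> zs)"
    if asm: "\<tau> < (1 + sqrt 5) / 2" "0 < \<alpha>" "\<alpha> \<le> 1" "pos_def G" "pos_def (H \<alpha>)" "pos_def (M \<alpha>)" for \<alpha>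
  proof -
    \<comment> \<open>Any KKT point starts the argument; the limit obtained below may be a different
      one.\<close>
    obtain y1 y2 y3 y where "kkt y1 y2 y3 y" using kkt_exists[OF assms(7,21)] .
    then obtain xs1 xs2 xs3 zs where kkt: "kkt xs1 xs2 xs3 zs"
      and lim: "x1 \<longlonglongrightarrow> xs1" "x2 \<longlonglongrightarrow> xs2" "x3 \<longlonglongrightarrow> xs3" "z \<longlonglongrightarrow> zs"
      by (rule convergence[OF _ asm(2,3,1,4-6)])
    from tendsto_Pair[OF lim(1) tendsto_Pair[OF lim(2,3)]] lim(4)
    show ?thesis using kkt_primal_optimal[OF kkt] kkt_dual_optimal[OF kkt] by blast
  qed
  show ?thesis
    unfolding Let_def r_def[symmetric]
  proof (rule conjI, goal_cases)
    case 1
    show ?case by (intro allI impI; elim conjE) (rule a)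
  next
    case 2
    show ?case by (rule impI, elim conjE exE) (rule b)
  qed
qed

end
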